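(* Fix a positive integer $d$. Let $\varepsilon_{\mathbb{R}}$ be the best possible (maximum) efficiency for a lattice covering of $\mathbb{R}^d$ by $\bar S_1$, and for each positive integer $k$ let $\varepsilon_{\mathbb{Z}}(k)$ be the best possible efficiency for a lattice covering of $\mathbb{Z}^d$ by $S_k$. Then $\varepsilon_{\mathbb{Z}}(k) = \varepsilon_{\mathbb{R}} + O(k^{-1})$ as $k \to \infty$. The same statement holds with $\bar S'_1$ in place of $\bar S_1$ and $S'_k$ in place of $S_k$.
   Context: For $k \ge 0$, in dimension $d$: $\bar S_k = \{x \in \mathbb{R}^d : |x_1|+\dots+|x_d| \le k\}$, $\bar S'_k = \{x \in \mathbb{R}^d : x_1,\dots,x_d \ge 0,\ x_1+\dots+x_d \le k\}$, $S_k = \bar S_k \cap \mathbb{Z}^d$, $S'_k = \bar S'_k \cap \mathbb{Z}^d$. A lattice in $\mathbb{R}^d$ (resp. $\mathbb{Z}^d$) is the set of all integer linear combinations of $d$ linearly independent vectors in $\mathbb{R}^d$ (resp. $\mathbb{Z}^d$). A lattice covering of $\mathbb{R}^d$ (resp. $\mathbb{Z}^d$) by a set $S$ is given by a lattice $L$ in $\mathbb{R}^d$ (resp. $\mathbb{Z}^d$) such that the translates $S+v$, $v\in L$, cover $\mathbb{R}^d$ (resp. $\mathbb{Z}^d$). The efficiency of a lattice covering of $\mathbb{R}^d$ by $S$ with lattice $L$ is $|\det M|/\mathrm{vol}(S)$, where $M$ is the matrix whose rows are generating vectors of $L$; the efficiency of a lattice covering of $\mathbb{Z}^d$ by a finite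 set $S$ with lattice $L$ is $|\mathbb{Z}^d : L|/|S|$. Efficiencies are at most $1$. *)

theory Defs
  imports "HOL-Analysis.Analysis" "HOL-Library.Landau_Symbols"
begin

definition S_bar :: "real \<Rightarrow> (real^'d) set" where
  "S_bar k = {x. (\<Sum>i\<in>UNIV. \<bar>x $ i\<bar>) \<le> k}"

definition S_bar' :: "real \<Rightarrow> (real^'d) set" where
  "S_bar' k = {x. (\<forall>i. x $ i \<ge> 0) \<and> (\<Sum>i\<in>UNIV. x $ i) \<le> k}"

text \<open>The group of integer vectors is treated as a subset of the real space, so that both
  kinds of covering share the same notion of lattice.\<close>

definition Zvec :: "(real^'d) set" where
  "Zvec = {x. \<forall>i. x $ i \<in> \<int>}"

definition S :: "real \<Rightarrow> (real^'d) set" where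
  "S k = S_bar k \<inter> Zvec"

definition S' :: "real \<Rightarrow> (real^'d) set" where
  "S' k = S_bar' k \<inter> Zvec"

text \<open>Injectivity is needed because \<^const>\<open>rows\<close> is a set and forgets repeated rows.\<close>

definition independent_rows :: "real^'d^'d \<Rightarrow> bool" where
  "independent_rows M \<longleftrightarrow> inj (\<lambda>i. row i M) \<and> independent (rows M)"

definition row_lattice :: "real^'d^'d \<Rightarrow> (real^'d) set" where
  "row_lattice M = range (\<lambda>c :: 'd \<Rightarrow> int. \<Sum>i\<in>UNIV. of_int (c i) *\<^sub>R row i M)"

definition int_lattice :: "(real^'d) set \<Rightarrow> bool" where
  "int_lattice L \<longleftrightarrow> (\<exists>M. independent_rows M \<and> rows M \<subseteq> Zvec \<and> L = row_lattice M)"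

definition translates_cover :: "(real^'d) set \<Rightarrow> (real^'d) set \<Rightarrow> (real^'d) set \<Rightarrow> bool" where
  "translates_cover X A L \<longleftrightarrow> X \<subseteq> (\<Union>v\<in>L. (\<lambda>x. x + v) ` A)"

definition int_index :: "(real^'d) set \<Rightarrow> nat" where
  "int_index L = card (Zvec // {(x, y). x \<in> Zvec \<and> y \<in> Zvec \<and> x - y \<in> L})"

definition real_efficiencies :: "(real^'d) set \<Rightarrow> real set" where
  "real_efficiencies A =
     {\<bar>det M\<bar> / measure lborel A | M. independent_rows M \<and> translates_cover UNIV A (row_lattice M)}"

definition int_efficiencies :: "(real^'d) set \<Rightarrow> real set" where
  "int_efficiencies A =
     {real (int_index L) / real (card A) | L. int_lattice L \<and> translates_cover Zvec A L}"

text \<open>\<^const>\<open>Greatest\<close> denotes an attained maximum, not merely a supremum; if there were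
  no maximum, its value would be unspecified.\<close>

definition best_real_efficiency :: "(real^'d) set \<Rightarrow> real" where
  "best_real_efficiency A = (GREATEST e. e \<in> real_efficiencies A)"

definition best_int_efficiency :: "(real^'d) set \<Rightarrow> real" where
  "best_int_efficiency A = (GREATEST e. e \<in> int_efficiencies A)"

end

theory Submission
  imports Defs "HOL-Real_Asymp.Real_Asymp"
begin

text \<open>The two discrete problems approximate the continuous one. From a covering of
  \<open>\<int>\<^sup>n\<close> by the integer points of radius \<open>k\<close> one gets a covering of \<open>\<real>\<^sup>n\<close> by the body of
  radius \<open>k + n\<close>, since every point lies within a unit cube of an integer point. Conversely,
  a basis of an optimal real lattice, scaled by \<open>k - p\<close> for a suitable constant \<open>p\<close> and rounded
  to integers, still covers with radius \<open>k\<close>. Both the determinants and the number of integer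
  points change only by a factor \<open>1 + O(1/k)\<close>. The maximal real efficiency exists by
  compactness: a covering lattice whose determinant is bounded below has a basis with bounded
  entries. The index of an integer lattice equals its determinant because unit cubes at coset
  representatives and the parallelepiped of a basis are both fundamental domains.\<close>

subsection \<open>Determinants and lattices\<close>

text \<open>A lattice has infinitely many bases with unbounded entries, so compactness applies only
  to bases chosen with bounded entries. A covering forces lattice vectors near every prescribed
  point; near the points with a single nonzero coordinate 2 they are automatically independent, and
  the lower bound on the determinant limits how often they must be improved to reach a basis. By
  Cramer's rule the same bound limits the coefficients that can carry a given point into the body,
  so being a covering is a closed condition on the basis. The simplex is not symmetric: only
  nonnegative perturbations are harmless. Hence cubes are anchored at their lowest corner, points
  are rounded down, and errors of either sign must first be shifted. Both bodies then fall under one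
  argument, in which a perturbation with coordinates between 0 and \<open>c\<close> costs the
  dimension times \<open>c\<close> in the radius.\<close>

lemma det_abs_le:
  fixes M :: "real^'n^'n"
  assumes "\<And>i j. \<bar>M $ i $ j\<bar> \<le> K"
  shows "\<bar>det M\<bar> \<le> fact CARD('n) * K ^ CARD('n)"
proof -
  have "\<bar>det M\<bar> \<le> (\<Sum>p | p permutes (UNIV::'n set). \<bar>of_int (sign p) * (\<Prod>i\<in>UNIV. M $ i $ p i)\<bar>)"
    unfolding det_def by (rule sum_abs)
  also have "\<dots> \<le> (\<Sum>p | p permutes (UNIV::'n set). K ^ CARD('n))"
  proof (rule sum_mono)
    fix p :: "'n \<Rightarrow> 'n"
    have "\<bar>of_int (sign p) * (\<Prod>i\<in>UNIV. M $ i $ p i)\<bar> = (\<Prod>i\<in>UNIV. \<bar>M $ i $ p i\<bar>)"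
      by (simp add: abs_mult abs_prod sign_def)
    also have "\<dots> \<le> (\<Prod>i\<in>(UNIV::'n set). K)"
      by (rule prod_mono) (simp add: assms)
    finally show "\<bar>of_int (sign p) * (\<Prod>i\<in>UNIV. M $ i $ p i)\<bar> \<le> K ^ CARD('n)" by simp
  qed
  also have "\<dots> = fact CARD('n) * K ^ CARD('n)"
    by (simp add: card_permutations)
  finally show ?thesis .
qed

text \<open>Measures how far rounding the entries disturbs the determinant; the loss
  \<open>C / (s - p)\<close> in \<open>int_covering_near_real\<close> comes from here.\<close>

lemma det_diff_le:
  fixes M N :: "real^'n^'n"
  assumes K: "K > 0" and M: "\<And>i j. \<bar>M $ i $ j\<bar> \<le> K" and N: "\<And>i j. \<bar>N $ i $ j\<bar> \<le> K"
    and e: "\<And>i j. \<bar>M $ i $ j - N $ i $ j\<bar> \<le> e"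
  shows "\<bar>det M - det N\<bar> \<le> fact CARD('n) * (K ^ CARD('n) * (real CARD('n) * (e / K)))"
proof -
  let ?P = "{p. p permutes (UNIV::'n set)}"
  have "det M - det N = (\<Sum>p\<in>?P. of_int (sign p) * ((\<Prod>i\<in>UNIV. M $ i $ p i) - (\<Prod>i\<in>UNIV. N $ i $ p i)))"
    unfolding det_def by (simp add: sum_subtractf right_diff_distrib)
  then have "\<bar>det M - det N\<bar> \<le> (\<Sum>p\<in>?P. \<bar>of_int (sign p) * ((\<Prod>i\<in>UNIV. M $ i $ p i) - (\<Prod>i\<in>UNIV. N $ i $ p i))\<bar>)"
    by (simp only: sum_abs)
  also have "\<dots> \<le> (\<Sum>p\<in>?P. K ^ CARD('n) * (real CARD('n) * (e / K)))"
  proof (rule sum_mono)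
    fix p :: "'n \<Rightarrow> 'n"
    have "\<bar>of_int (sign p) * ((\<Prod>i\<in>UNIV. M $ i $ p i) - (\<Prod>i\<in>UNIV. N $ i $ p i))\<bar>
        = \<bar>(\<Prod>i\<in>UNIV. M $ i $ p i) - (\<Prod>i\<in>UNIV. N $ i $ p i)\<bar>"
      by (simp add: abs_mult sign_def)
    \<comment> \<open>Dividing by \<open>K\<close> makes every factor at most 1 in absolute value,
      as \<open>norm_prod_diff\<close> requires.\<close>
    also have "\<dots> = \<bar>(\<Prod>i\<in>UNIV. K * (M $ i $ p i / K)) - (\<Prod>i\<in>UNIV. K * (N $ i $ p i / K))\<bar>"
      using K by simp
    also have "\<dots> = K ^ CARD('n) * \<bar>(\<Prod>i\<in>UNIV. M $ i $ p i / K) - (\<Prod>i\<in>UNIV. N $ i $ p i / K)\<bar>"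
      unfolding prod.distrib using K by (simp add: abs_mult right_diff_distrib[symmetric])
    also have "\<dots> \<le> K ^ CARD('n) * (\<Sum>i\<in>(UNIV::'n set). \<bar>M $ i $ p i / K - N $ i $ p i / K\<bar>)"
      using norm_prod_diff[of UNIV "\<lambda>i. M $ i $ p i / K" "\<lambda>i. N $ i $ p i / K"] K M N
      by (intro mult_left_mono) auto
    also have "\<dots> \<le> K ^ CARD('n) * (\<Sum>i\<in>(UNIV::'n set). e / K)"
      using K e by (intro mult_left_mono sum_mono)
        (auto simp: diff_divide_distrib[symmetric] divide_right_mono)
    finally show "\<bar>of_int (sign p) * ((\<Prod>i\<in>UNIV. M $ i $ p i) - (\<Prod>i\<in>UNIV. N $ i $ p i))\<bar>
        \<le> K ^ CARD('n) * (real CARD('n) * (e / K))" by simp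
  qed
  also have "\<dots> = fact CARD('n) * (K ^ CARD('n) * (real CARD('n) * (e / K)))"
    by (simp add: card_permutations)
  finally show ?thesis .
qed

lemma vector_matrix_mult_row_sum:
  fixes M :: "real^'n^'n"
  shows "c v* M = (\<Sum>i\<in>UNIV. (c $ i) *\<^sub>R row i M)"
  by (simp add: vec_eq_iff vector_matrix_mult_def row_def sum_component)

lemma cramer_rows:
  fixes M :: "real^'n^'n"
  shows "det (\<chi> i. if i = k then c v* M else row i M) = c $ k * det M"
proof -
  have *: "c v* M = sum (\<lambda>i. c $ i *s row i M) UNIV"
    by (simp add: vec_eq_iff vector_matrix_mult_def row_def sum_component)
  show ?thesis
    unfolding * by (rule cramer_lemma_transpose)
qed

text \<open>Each coordinate is a quotient of two determinants. This leaves finitely many relevant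
  translates for a given point, and bounds the coordinates of points of the body relative to a fixed
  basis.\<close>

lemma cramer_bound:
  fixes M :: "real^'n^'n"
  assumes "\<And>i j. \<bar>M $ i $ j\<bar> \<le> K" "\<And>j. \<bar>(c v* M) $ j\<bar> \<le> K" "\<delta> \<le> \<bar>det M\<bar>" "\<delta> > 0"
  shows "\<bar>c $ k\<bar> \<le> fact CARD('n) * K ^ CARD('n) / \<delta>"
proof -
  have "\<bar>c $ k\<bar> * \<delta> \<le> \<bar>c $ k\<bar> * \<bar>det M\<bar>"
    by (rule mult_left_mono) (use assms in auto)
  also have "\<dots> = \<bar>det (\<chi> i. if i = k then c v* M else row i M)\<bar>"
    by (simp only: cramer_rows abs_mult)
  also have "\<dots> \<le> fact CARD('n) * K ^ CARD('n)"
    by (rule det_abs_le) (use assms in \<open>auto simp: row_def\<close>)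
  finally show ?thesis using assms by (simp add: field_simps)
qed

section \<open>Integer vectors\<close>

lemma Zvec_diff: "x \<in> Zvec \<Longrightarrow> y \<in> Zvec \<Longrightarrow> x - y \<in> Zvec"
  and Zvec_add: "x \<in> Zvec \<Longrightarrow> y \<in> Zvec \<Longrightarrow> x + y \<in> Zvec"
  and Zvec_0: "0 \<in> Zvec"
  by (auto simp: Zvec_def)

lemma Zvec_mult_matrix:
  assumes "c \<in> Zvec" "\<And>i. M $ i \<in> Zvec"
  shows "c v* M \<in> Zvec"
  using assms by (auto simp: Zvec_def vector_matrix_mult_def)

lemma Zvec_eq_range: "Zvec = range (\<lambda>c. \<chi> i. of_int (c i))"
proof -
  have "x \<in> range (\<lambda>c. \<chi> i. of_int (c i))" if "x \<in> Zvec" for x :: "real^'n"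
  proof (rule range_eqI)
    show "x = (\<chi> i. of_int (\<lfloor>x $ i\<rfloor>))"
      using that by (simp add: Zvec_def vec_eq_iff)
  qed
  then show ?thesis by (auto simp: Zvec_def)
qed

lemma countable_Zvec: "countable (Zvec :: (real^'n) set)"
proof -
  have "countable (UNIV :: ('n \<Rightarrow> int) set)"
    by simp
  then show ?thesis
    unfolding Zvec_eq_range by (rule countable_image)
qed

text \<open>Together with countability this yields a bijective enumeration by the naturals, used for
  countable sums of volumes.\<close>

lemma infinite_Zvec: "infinite (Zvec :: (real^'n) set)"
proof -
  have "inj (\<lambda>m::int. (\<chi> i. of_int m) :: real^'n)"
    by (auto simp: inj_def vec_eq_iff)
  then have "infinite (range (\<lambda>m::int. (\<chi> i. of_int m) :: real^'n))"
    using finite_imageD infinite_UNIV_int by blast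
  moreover have "range (\<lambda>m::int. (\<chi> i. of_int m) :: real^'n) \<subseteq> Zvec"
    by (auto simp: Zvec_def)
  ultimately show ?thesis using finite_subset by blast
qed

lemma finite_bounded_Zvec:
  fixes A :: "(real^'n) set"
  assumes "\<And>x i. x \<in> A \<Longrightarrow> \<bar>x $ i\<bar> \<le> K"
  shows "finite (A \<inter> Zvec)"
proof (rule finite_subset)
  let ?f = "\<lambda>c::'n \<Rightarrow> int. (\<chi> i. of_int (c i)) :: real^'n"
  show "A \<inter> Zvec \<subseteq> ?f ` (PiE UNIV (\<lambda>_. {-\<lceil>K\<rceil>..\<lceil>K\<rceil>}))"
  proof
    fix x assume x: "x \<in> A \<inter> Zvec"
    then obtain c where c: "x = ?f c" unfolding Zvec_eq_range by auto
    have "\<bar>c i\<bar> \<le> \<lceil>K\<rceil>" for i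
    proof -
      have "\<bar>real_of_int (c i)\<bar> \<le> K" using assms[of x i] x c by auto
      then show ?thesis by linarith
    qed
    then have "c \<in> PiE UNIV (\<lambda>_. {-\<lceil>K\<rceil>..\<lceil>K\<rceil>})"
      by (auto simp: abs_le_iff) (metis minus_le_iff)
    then show "x \<in> ?f ` (PiE UNIV (\<lambda>_. {-\<lceil>K\<rceil>..\<lceil>K\<rceil>}))" using c by auto
  qed
  show "finite (?f ` (PiE UNIV (\<lambda>_. {-\<lceil>K\<rceil>..\<lceil>K\<rceil>})))"
    by (intro finite_imageI finite_PiE) auto
qed

section \<open>Row lattices and bounded bases\<close>

lemma row_lattice_eq: "row_lattice M = (\<lambda>c. c v* M) ` Zvec"
  unfolding row_lattice_def Zvec_eq_range image_image
  by (simp add: vector_matrix_mult_row_sum)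

text \<open>The working form of a covering: a translate is named by its integer coefficients, to
  which Cramer's rule applies.\<close>

lemma translates_cover_row_lattice:
  "translates_cover X A (row_lattice M) \<longleftrightarrow> (\<forall>x\<in>X. \<exists>c\<in>Zvec. x - c v* M \<in> A)"
  unfolding translates_cover_def row_lattice_eq
  by (auto simp: image_iff subset_eq) (metis add_diff_cancel_right' diff_add_cancel)+

lemma independent_rows_iff_det: "independent_rows (M :: real^'n^'n) \<longleftrightarrow> det M \<noteq> 0"
proof
  assume M: "independent_rows M"
  show "det M \<noteq> 0"
  proof
    assume "det M = 0"
    then have "\<not> (\<exists>B. M ** B = mat 1)"
      using invertible_det_nz invertible_right_inverse by blast
    then obtain c i where c: "sum (\<lambda>i. c i *s row i M) UNIV = 0" "c i \<noteq> 0"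
      unfolding matrix_right_invertible_independent_rows by blast
    have inj: "inj (\<lambda>i. row i M)" and ind: "independent (rows M)"
      using M unfolding independent_rows_def by auto
    \<comment> \<open>The dependence has coefficients by row index, while \<open>independent\<close>
      speaks of a set of vectors; injectivity lets \<open>u\<close> carry them over.\<close>
    define u where "u v = c (inv (\<lambda>i. row i M) v)" for v
    have rows: "rows M = range (\<lambda>i. row i M)" by (auto simp: rows_def)
    have "(\<Sum>v\<in>rows M. u v *\<^sub>R v) = (\<Sum>i\<in>UNIV. u (row i M) *\<^sub>R row i M)"
      unfolding rows by (subst sum.reindex[OF inj]) simp
    also have "\<dots> = 0"
      using c(1) by (simp add: u_def inv_f_f[OF inj] scalar_mult_eq_scaleR)
    finally have "u (row i M) = 0"
      using ind independentD[OF ind, of "rows M" u "row i M"] rows by auto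
    then show False using c(2) by (simp add: u_def inv_f_f[OF inj])
  qed
next
  assume d: "det M \<noteq> 0"
  have "inj (\<lambda>i. row i M)"
    by (rule injI) (use d det_identical_rows in blast)
  moreover have "independent (rows M)"
    using d det_dependent_rows vec.dependent_def dependent_raw_def  
    by (metis dependent_vec_eq)
  ultimately show "independent_rows M" unfolding independent_rows_def by auto
qed

text \<open>The integer factor \<open>C\<close> makes \<open>det V\<close> an integer multiple of
  \<open>det M\<close>, which drives the descent to a basis.\<close>

lemma row_lattice_subsetE:
  assumes "\<And>i. V $ i \<in> row_lattice M"
  obtains C where "\<And>i. C $ i \<in> Zvec" "V = C ** M"
proof -
  have "\<forall>i. \<exists>c. c \<in> Zvec \<and> V $ i = c v* M"
    using assms unfolding row_lattice_eq by auto
  then obtain c where c: "\<And>i. c i \<in> Zvec" "\<And>i. V $ i = c i v* M"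
    by metis
  show thesis
  proof (rule that)
    show "(\<chi> i. c i) $ i \<in> Zvec" for i using c by simp
    show "V = (\<chi> i. c i) ** M"
      by (simp add: vec_eq_iff c matrix_matrix_mult_def vector_matrix_mult_def)
  qed
qed

lemma row_lattice_subset:
  assumes "\<And>i. V $ i \<in> row_lattice M"
  shows "row_lattice V \<subseteq> row_lattice M"
proof -
  obtain C where C: "\<And>i. C $ i \<in> Zvec" "V = C ** M"
    using row_lattice_subsetE[OF assms] by blast
  have "c v* V = (c v* C) v* M" for c
    by (simp add: C vector_matrix_mul_assoc)
  then show ?thesis
    unfolding row_lattice_eq using Zvec_mult_matrix C(1) by fastforce
qed

lemma row_in_row_lattice: "M $ i \<in> row_lattice M"
proof -
  have "M $ i = axis i 1 v* M"
    by (simp add: vec_eq_iff vector_matrix_mult_def axis_def if_distrib[of "\<lambda>x. x * _"] cong: if_cong)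
  moreover have "axis i 1 \<in> Zvec" by (auto simp: Zvec_def axis_def)
  ultimately show ?thesis unfolding row_lattice_eq by blast
qed

lemma row_lattice_diff:
  "x \<in> row_lattice M \<Longrightarrow> y \<in> row_lattice M \<Longrightarrow> x - y \<in> row_lattice M"
  unfolding row_lattice_eq
  by (auto simp: vector_matrix_mult_diff_distrib[symmetric] Zvec_diff intro!: imageI)

lemma row_action_surj:
  fixes M :: "real^'n^'n"
  assumes "det M \<noteq> 0"
  obtains t where "t v* M = x"
proof -
  obtain N where "N ** M = mat 1"
    using assms invertible_det_nz invertible_def by blast
  then have "(x v* N) v* M = x" by (simp add: vector_matrix_mul_assoc)
  then show thesis by (rule that)
qed

lemma det_integer_matrix:
  fixes C :: "real^'n^'n"
  assumes "\<And>i. C $ i \<in> Zvec"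
  shows "det C \<in> \<int>"
  unfolding det_def using assms
  by (auto intro!: Ints_sum Ints_mult Ints_prod simp: Zvec_def)

lemma Ints_abs_ge_1: "x \<in> \<int> \<Longrightarrow> x \<noteq> 0 \<Longrightarrow> \<bar>x::real\<bar> \<ge> 1"
  by (auto elim!: Ints_cases)

text \<open>If the rows of \<open>V\<close> do not generate the lattice, reducing a missing vector modulo them
  leaves coefficients of size at most \<open>1/2\<close>; exchanging it for a row at least halves the
  determinant. A nonzero determinant is an integer multiple of \<open>det M\<close>, so this stops.\<close>

lemma bounded_lattice_basis:
  fixes M V :: "real^'n^'n"
  assumes "det V \<noteq> 0" "\<And>i. V $ i \<in> row_lattice M" "\<And>i j. \<bar>V $ i $ j\<bar> \<le> K"
    and "\<bar>det V\<bar> < 2 ^ m * \<bar>det M\<bar>"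
  shows "\<exists>B. row_lattice B = row_lattice M \<and> \<bar>det B\<bar> = \<bar>det M\<bar> \<and>
    (\<forall>i j. \<bar>B $ i $ j\<bar> \<le> real CARD('n) ^ m * K)"
  using assms
proof (induction m arbitrary: V K)
  \<comment> \<open>Vacuous: \<open>det C\<close> is a nonzero integer, so \<open>det V\<close> is
    at least \<open>det M\<close> in absolute value, against the hypothesis for exponent 0.\<close>
  case 0
  obtain C where C: "\<And>i. C $ i \<in> Zvec" "V = C ** M"
    using row_lattice_subsetE[OF 0(2)] by blast
  have "det C \<noteq> 0" using 0 C by (auto simp: det_mul)
  then have "\<bar>det C\<bar> \<ge> 1" using Ints_abs_ge_1 det_integer_matrix C by blast
  then have "1 * \<bar>det M\<bar> \<le> \<bar>det C\<bar> * \<bar>det M\<bar>" by (intro mult_right_mono) auto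
  then show ?case using 0(4) C by (simp add: det_mul abs_mult)
next
  case (Suc m)
  obtain C where C: "\<And>i. C $ i \<in> Zvec" "V = C ** M"
    using row_lattice_subsetE[OF Suc.prems(2)] by blast
  have K: "K \<ge> 0" using Suc.prems(3) abs_ge_zero order_trans by blast
  have n: "real CARD('n) \<ge> 1" by (simp add: Suc_leI)
  show ?case
  proof (cases "\<forall>j. M $ j \<in> row_lattice V")
    case True
    \<comment> \<open>Mutual containment: both change-of-basis determinants are nonzero integers, so
      each of the two determinants bounds the other.\<close>
    then obtain D where D: "\<And>i. D $ i \<in> Zvec" "M = D ** V"
      using row_lattice_subsetE by metis
    have "det C \<noteq> 0" using Suc.prems C by (auto simp: det_mul)
    moreover have "det D \<noteq> 0" using Suc.prems D by (auto simp: det_mul)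
    ultimately have "\<bar>det C\<bar> \<ge> 1" "\<bar>det D\<bar> \<ge> 1"
      using Ints_abs_ge_1 det_integer_matrix C D by blast+
    then have "1 * \<bar>det M\<bar> \<le> \<bar>det C\<bar> * \<bar>det M\<bar>" "1 * \<bar>det V\<bar> \<le> \<bar>det D\<bar> * \<bar>det V\<bar>"
      by (intro mult_right_mono; simp)+
    moreover have "\<bar>det V\<bar> = \<bar>det C\<bar> * \<bar>det M\<bar>"
      unfolding C(2) by (simp add: det_mul abs_mult)
    moreover have "\<bar>det M\<bar> = \<bar>det D\<bar> * \<bar>det V\<bar>"
      by (subst D(2)) (simp add: det_mul abs_mult)
    ultimately have "\<bar>det V\<bar> = \<bar>det M\<bar>" by linarith
    moreover have "row_lattice V = row_lattice M"
      using row_lattice_subset[of V M] row_lattice_subset[of M V] True Suc.prems(2) by blast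
    moreover have "\<bar>V $ i $ j\<bar> \<le> real CARD('n) ^ Suc m * K" for i j
    proof -
      have "1 * K \<le> real CARD('n) ^ Suc m * K"
        by (intro mult_right_mono one_le_power n K)
      then show ?thesis using Suc.prems(3)[of i j] by simp
    qed
    ultimately show ?thesis by blast
  next
    case False
    then obtain j where j: "M $ j \<notin> row_lattice V" by blast
    obtain t where tV: "t v* V = M $ j"
      using row_action_surj[OF Suc.prems(1)] by blast
    define r :: "real^'n" where "r = (\<chi> i. of_int (round (t $ i)))"
    define s where "s = t - r"
    define w where "w = s v* V"
    have r: "r \<in> Zvec" by (simp add: Zvec_def r_def)
    have s: "\<bar>s $ i\<bar> \<le> 1/2" for i
      using of_int_round_abs_le[of "t $ i"] by (simp add: s_def r_def abs_minus_commute)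
    have w: "w = M $ j - r v* V"
      by (simp add: w_def s_def vector_matrix_mult_diff_distrib tV)
    have "r v* V \<in> row_lattice V" using r by (auto simp: row_lattice_eq)
    then have "r v* V \<in> row_lattice M" using row_lattice_subset Suc.prems(2) by blast
    then have wL: "w \<in> row_lattice M"
      unfolding w by (intro row_lattice_diff row_in_row_lattice)
    \<comment> \<open>An integral \<open>s\<close> would put \<open>M $ j\<close> into the lattice
      of \<open>V\<close>. So some coefficient of \<open>s\<close> is nonzero, and exchanging that
      row keeps the determinant nonzero.\<close>
    have "s \<notin> Zvec"
    proof
      assume "s \<in> Zvec"
      then have "t \<in> Zvec" using Zvec_add[OF _ r, of s] by (simp add: s_def)
      then show False using j tV unfolding row_lattice_eq by (metis imageI)
    qed
    then obtain k where k: "s $ k \<noteq> 0" by (auto simp: Zvec_def) (metis Ints_0)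
    define W where "W = (\<chi> i. if i = k then w else row i V)"
    have detW: "det W = s $ k * det V"
      unfolding W_def w_def by (rule cramer_rows)
    \<comment> \<open>Weakening 1/2 to 1 gives the dimension times \<open>K\<close>, which is at
      least \<open>K\<close> and thus also holds for the rows that stay.\<close>
    have "\<bar>w $ j\<bar> \<le> real CARD('n) * K" for j
    proof -
      have "\<bar>w $ j\<bar> \<le> (\<Sum>i\<in>UNIV. \<bar>s $ i * V $ i $ j\<bar>)"
        unfolding w_def vector_matrix_mult_def by (simp add: sum_abs)
      also have "\<dots> \<le> (\<Sum>i\<in>(UNIV::'n set). 1 * K)"
        unfolding abs_mult
        by (intro sum_mono mult_mono order_trans[OF s] Suc.prems) (auto simp: K)
      finally show ?thesis by simp
    qed
    moreover have "\<bar>V $ i $ j\<bar> \<le> real CARD('n) * K" for i j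
      using Suc.prems(3)[of i j] mult_right_mono[OF n K] by linarith
    ultimately have W3: "\<bar>W $ i $ j\<bar> \<le> real CARD('n) * K" for i j
      by (simp add: W_def row_def)
    have W2: "W $ i \<in> row_lattice M" for i
      using wL Suc.prems(2) by (simp add: W_def row_def)
    have "\<bar>s $ k\<bar> * \<bar>det V\<bar> \<le> 1/2 * \<bar>det V\<bar>"
      by (intro mult_right_mono s) auto
    then have W4: "\<bar>det W\<bar> < 2 ^ m * \<bar>det M\<bar>"
      using Suc.prems(4) by (simp add: detW abs_mult)
    have "det W \<noteq> 0" using k Suc.prems(1) detW by simp
    from Suc.IH[OF this W2 W3 W4] show ?thesis by (simp add: mult_ac)
  qed
qed

subsection \<open>Packing and covering by lattice translates\<close>

lemma emeasure_lebesgue_translation: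
  "emeasure lebesgue ((+) a ` X) = emeasure lebesgue (X :: 'a::euclidean_space set)"
  using emeasure_lebesgue_affine[of 1 a X] by (simp add: ac_simps cong: image_cong_simp)

text \<open>Each piece of \<open>F\<close> is moved by a lattice vector into \<open>D\<close>; the moved pieces stay disjoint.\<close>

lemma packing_le_covering:
  fixes F D :: "(real^'n) set" and M :: "real^'n^'n"
  assumes F: "F \<in> lmeasurable" and D: "D \<in> lmeasurable"
    and pack: "\<And>x y c. x \<in> F \<Longrightarrow> y \<in> F \<Longrightarrow> c \<in> Zvec \<Longrightarrow> x - y = c v* M \<Longrightarrow> c = 0"
    and cover: "\<And>x. \<exists>c\<in>Zvec. x - c v* M \<in> D"
  shows "measure lebesgue F \<le> measure lebesgue D"
proof -
  define e :: "nat \<Rightarrow> real^'n" where "e = from_nat_into Zvec"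
  have e: "bij_betw e UNIV Zvec"
    unfolding e_def by (intro bij_betw_from_nat_into countable_Zvec infinite_Zvec)
  define v where "v n = e n v* M" for n
  have [measurable]: "F \<in> sets lebesgue" "D \<in> sets lebesgue"
    using F D by auto
  have vD: "(+) (v n) ` D \<in> sets lebesgue" and vF: "(+) (- v n) ` F \<in> sets lebesgue" for n
    using measurable_translation F D by blast+
  have "F \<subseteq> (\<Union>n. F \<inter> (+) (v n) ` D)"
  proof
    fix x assume x: "x \<in> F"
    obtain c where c: "c \<in> Zvec" "x - c v* M \<in> D" using cover by blast
    then obtain n where "e n = c" using e by (metis bij_betw_imp_surj_on imageE)
    then have "x \<in> (+) (v n) ` D"
      using c(2) by (intro image_eqI[of _ _ "x - c v* M"]) (auto simp: v_def)
    then show "x \<in> (\<Union>n. F \<inter> (+) (v n) ` D)" using x by blast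
  qed
  then have "emeasure lebesgue F \<le> emeasure lebesgue (\<Union>n. F \<inter> (+) (v n) ` D)"
    using vD by (intro emeasure_mono) auto
  \<comment> \<open>The pieces of \<open>F\<close> may overlap here, which subadditivity tolerates;
    disjointness enters only after they are moved into \<open>D\<close>.\<close>
  also have "\<dots> \<le> (\<Sum>n. emeasure lebesgue (F \<inter> (+) (v n) ` D))"
    using vD by (intro emeasure_subadditive_countably) auto
  also have "\<dots> = (\<Sum>n. emeasure lebesgue ((+) (- v n) ` F \<inter> D))"
  proof (rule suminf_cong)
    fix n
    have "F \<inter> (+) (v n) ` D = (+) (v n) ` ((+) (- v n) ` F \<inter> D)"
      by (force simp: image_iff algebra_simps)
    then show "emeasure lebesgue (F \<inter> (+) (v n) ` D) = emeasure lebesgue ((+) (- v n) ` F \<inter> D)"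
      by (simp only: emeasure_lebesgue_translation)
  qed
  also have "\<dots> = emeasure lebesgue (\<Union>n. (+) (- v n) ` F \<inter> D)"
  proof (rule suminf_emeasure)
    show "range (\<lambda>n. (+) (- v n) ` F \<inter> D) \<subseteq> sets lebesgue" using vF by auto
    show "disjoint_family (\<lambda>n. (+) (- v n) ` F \<inter> D)"
      unfolding disjoint_family_on_def
    proof (intro ballI impI)
      fix m n :: nat assume "m \<noteq> n"
      then have ne: "e m - e n \<noteq> 0" using e by (auto simp: bij_betw_def inj_def)
      have z: "e m - e n \<in> Zvec" using e by (auto simp: bij_betw_def intro!: Zvec_diff)
      have False if "x \<in> F" "y \<in> F" "- v m + x = - v n + y" for x y
      proof -
        have "x - y = (e m - e n) v* M"
          using that(3) by (simp add: v_def vector_matrix_mult_diff_distrib algebra_simps)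
        from pack[OF that(1,2) z this] ne show False by simp
      qed
      then show "(+) (- v m) ` F \<inter> D \<inter> ((+) (- v n) ` F \<inter> D) = {}" by blast
    qed
  qed
  also have "\<dots> \<le> emeasure lebesgue D" by (intro emeasure_mono) auto
  finally show ?thesis
    using F D by (simp add: emeasure_eq_measure2 fmeasurableD2)
qed

section \<open>The half-open unit cube\<close>

text \<open>Half-open, so that its integer translates partition the space: each point lies in
  exactly one of them, the one at its floor.\<close>

definition half_box :: "(real^'n) set" where
  "half_box = {u. \<forall>i. 0 \<le> u $ i \<and> u $ i < 1}"

lemma half_box_floor: "x - (\<chi> i. of_int \<lfloor>x $ i\<rfloor>) \<in> half_box"
  by (simp add: half_box_def) linarith

lemma half_box_unique:
  assumes "x \<in> half_box" "y \<in> half_box" "x - y \<in> Zvec"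
  shows "x = y"
proof -
  have "x $ i - y $ i = 0" for i
  proof (rule ccontr)
    assume "x $ i - y $ i \<noteq> 0"
    moreover have "x $ i - y $ i \<in> \<int>" using assms by (auto simp: Zvec_def)
    ultimately have "\<bar>x $ i - y $ i\<bar> \<ge> 1" using Ints_abs_ge_1 by blast
    moreover have "0 \<le> x $ i" "x $ i < 1" "0 \<le> y $ i" "y $ i < 1"
      using assms by (auto simp: half_box_def)
    ultimately show False by linarith
  qed
  then show ?thesis by (simp add: vec_eq_iff)
qed

text \<open>It lies between the open and the closed unit box, both of volume 1.\<close>

lemma half_box_lmeasurable: "(half_box :: (real^'n) set) \<in> lmeasurable"
  and measure_half_box: "measure lebesgue (half_box :: (real^'n) set) = 1"
proof -
  have "{u \<in> space borel. \<forall>i. 0 \<le> u $ i \<and> u $ i < 1} \<in> sets (borel :: (real^'n) measure)"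
    by measurable
  then have borel: "(half_box :: (real^'n) set) \<in> sets borel"
    by (simp add: half_box_def)
  have "box 0 1 \<subseteq> (half_box :: (real^'n) set)" "(half_box :: (real^'n) set) \<subseteq> cbox 0 1"
    by (auto simp: half_box_def mem_box_cart less_imp_le)
  then have "emeasure lebesgue (box 0 (1::real^'n)) \<le> emeasure lebesgue (half_box :: (real^'n) set)"
    "emeasure lebesgue (half_box :: (real^'n) set) \<le> emeasure lebesgue (cbox 0 (1::real^'n))"
    using borel by (auto intro!: emeasure_mono)
  moreover have one: "(1::real^'n) = \<Sum>Basis"
  proof -
    have "(\<Sum>Basis) $ i = (\<Sum>Basis :: real^'n) \<bullet> axis i 1" for i
      by (rule cart_eq_inner_axis)
    then show ?thesis by (simp add: vec_eq_iff)
  qed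
  have "emeasure lebesgue (box 0 (1::real^'n)) = 1" "emeasure lebesgue (cbox 0 (1::real^'n)) = 1"
    unfolding one by (simp_all add: emeasure_lborel_box_eq emeasure_lborel_cbox_eq)
  ultimately have "emeasure lebesgue (half_box :: (real^'n) set) = 1" by simp
  then show "(half_box :: (real^'n) set) \<in> lmeasurable"
    "measure lebesgue (half_box :: (real^'n) set) = 1"
    using borel by (auto simp: fmeasurable_def measure_def)
qed

section \<open>Volumes of linear images\<close>

text \<open>Bundling linearity and measurability with the volume formula gives a property stable
  under composition, as induction over elementary maps demands.\<close>

definition volume_by_det :: "(real^'n \<Rightarrow> real^'n) \<Rightarrow> bool" where
  "volume_by_det f \<longleftrightarrow> linear f \<and> (\<forall>X\<in>lmeasurable. f ` X \<in> lmeasurable \<and>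
     measure lebesgue (f ` X) = \<bar>det (matrix f)\<bar> * measure lebesgue X)"

lemma volume_by_det_compose:
  assumes "volume_by_det f" "volume_by_det g"
  shows "volume_by_det (f \<circ> g)"
  using assms matrix_compose[of g f] unfolding volume_by_det_def
  by (simp add: linear_compose image_comp[symmetric] det_mul abs_mult del: o_apply image_comp)

lemma volume_by_det_singular:
  assumes "linear f" "\<not> inj f"
  shows "volume_by_det f"
proof -
  have "negligible (f ` X)" for X
    using assms by (rule negligible_linear_singular_image)
  moreover have "det (matrix f) = 0"
    using assms det_nz_iff_inj by blast
  ultimately show ?thesis
    using assms(1) by (simp add: volume_by_det_def negligible_iff_measure)
qed

lemma volume_by_det_stretch: "volume_by_det (\<lambda>x::real^'n. \<chi> i. c i * x $ i)"
proof -
  have "linear (\<lambda>x::real^'n. \<chi> i. c i * x $ i)"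
    by (rule linearI) (simp_all add: vec_eq_iff algebra_simps)
  moreover have "det (matrix (\<lambda>x::real^'n. \<chi> i. c i * x $ i)) = prod c UNIV"
    by (simp add: matrix_def axis_def det_diagonal)
  ultimately show ?thesis
    by (simp add: volume_by_det_def measurable_stretch measure_stretch)
qed

lemma volume_by_det_shear:
  fixes m n :: "'n::finite"
  assumes "m \<noteq> n"
  shows "volume_by_det (\<lambda>x. \<chi> i. if i = m then x $ m + x $ n else x $ i)"
proof -
  let ?h = "\<lambda>x::real^'n. (\<chi> i. if i = m then x $ m + x $ n else x $ i) :: real^'n"
  have lin: "linear ?h"
    by (rule linearI) (auto simp: vec_eq_iff algebra_simps)
  have "matrix ?h $ i $ j
      = (\<chi> k. if k = m then row m (mat 1) + 1 *s row n (mat 1) else row k (mat 1)) $ i $ j" for i j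
    by (cases "i = m") (simp_all add: matrix_def row_def mat_def axis_def eq_commute[of j])
  then have "matrix ?h = (\<chi> k. if k = m then row m (mat 1) + 1 *s row n (mat 1) else row k (mat 1))"
    unfolding vec_eq_iff by blast
  then have det: "det (matrix ?h) = 1"
    using det_row_operation[OF assms, of "mat 1 :: real^'n^'n" 1] by simp
  have box: "measure lebesgue (?h ` cbox a b) = 1 * measure lebesgue (cbox a b)" for a b
  proof (cases "cbox a b = {}")
    case False
    \<comment> \<open>Translating by \<open>?t\<close> makes the lower bound of the box in
      coordinate \<open>n\<close> equal to 0, as \<open>measure_shear_interval\<close> wants it
      nonnegative; linearity of the shear pulls the translation back out.\<close>
    let ?t = "axis n (a $ n) :: real^'n"
    have ab: "cbox a b = (+) ?t ` cbox (a - ?t) (b - ?t)"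
      by (simp add: cbox_translation[symmetric])
    have "?h ` cbox a b = (+) (?h ?t) ` ?h ` cbox (a - ?t) (b - ?t)"
      unfolding ab image_image by (simp only: linear_add[OF lin])
    then have "measure lebesgue (?h ` cbox a b) = measure lebesgue (?h ` cbox (a - ?t) (b - ?t))"
      by (simp only: measure_translation)
    also have "\<dots> = measure lebesgue (cbox (a - ?t) (b - ?t))"
    proof (rule measure_shear_interval[OF assms])
      show "cbox (a - ?t) (b - ?t) \<noteq> {}" using False unfolding ab by blast
    qed simp
    also have "\<dots> = measure lebesgue (cbox a b)"
      unfolding ab by (rule measure_translation[symmetric])
    finally show ?thesis by simp
  qed simp
  have *: "?h ` X \<in> lmeasurable \<and> 1 * measure lebesgue X = measure lebesgue (?h ` X)"
    if "X \<in> lmeasurable" for X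
    by (rule measure_linear_sufficient[where f="?h" and m=1, OF lin that]) (rule box)
  have "?h ` X \<in> lmeasurable" "measure lebesgue (?h ` X) = \<bar>1\<bar> * measure lebesgue X"
    if "X \<in> lmeasurable" for X
    unfolding abs_one by (rule conjunct1[OF *[OF that]], rule conjunct2[OF *[OF that], symmetric])
  then show ?thesis
    unfolding volume_by_det_def det using lin by blast
qed

text \<open>The library's \<open>measure_linear_image\<close> demands a well-ordered index type, which a
  general finite type does not have.\<close>

lemma volume_by_det_linear:
  fixes f :: "real^'n \<Rightarrow> real^'n"
  assumes "linear f"
  shows "volume_by_det f"
  using assms
proof (rule induct_linear_elementary)
  fix f :: "real^'n \<Rightarrow> real^'n" and i assume f: "linear f" "\<And>x. f x $ i = 0"
  then have "\<not> surj f" by (metis surjE vec_component zero_neq_one)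
  then show "volume_by_det f"
    using f linear_injective_imp_surjective volume_by_det_singular by blast
next
  fix m n :: 'n assume mn: "m \<noteq> n"
  define N where "N = (\<lambda>x::real^'n. (\<chi> i. (if i = n then -1 else 1) * x $ i) :: real^'n)"
  define A where "A m n = (\<lambda>x::real^'n. (\<chi> i. if i = m then x $ m + x $ n else x $ i) :: real^'n)" for m n
  \<comment> \<open>A swap from shears and sign changes. On the coordinates \<open>m\<close>,
    \<open>n\<close> it runs (x, y), (x+y, y), (x+y, -y), (x+y, x), (x+y, -x), (y, -x), (y,
    x).\<close>
  have "(\<lambda>x::real^'n. (\<chi> i. x $ Transposition.transpose m n i) :: real^'n)
      = N \<circ> (A m n \<circ> (N \<circ> (A n m \<circ> (N \<circ> A m n))))"
  proof (intro ext, unfold vec_eq_iff, intro allI)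
    fix x :: "real^'n" and i
    consider "i = m" | "i = n" | "i \<noteq> m" "i \<noteq> n" by blast
    then show "(\<chi> i. x $ Transposition.transpose m n i) $ i
        = (N \<circ> (A m n \<circ> (N \<circ> (A n m \<circ> (N \<circ> A m n))))) x $ i"
      using mn by cases (simp_all add: N_def A_def)
  qed
  moreover have "volume_by_det N" unfolding N_def by (rule volume_by_det_stretch)
  moreover have "volume_by_det (A m n)" "volume_by_det (A n m)"
    unfolding A_def using mn by (auto intro: volume_by_det_shear)
  ultimately show "volume_by_det (\<lambda>x::real^'n. (\<chi> i. x $ Transposition.transpose m n i) :: real^'n)"
    by (simp only: volume_by_det_compose)
qed (rule volume_by_det_compose volume_by_det_stretch volume_by_det_shear; assumption)+

text \<open>The image is the parallelepiped spanned by the rows; acting on rows is multiplication by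
  the transpose, which has the same determinant.\<close>

lemma fundamental_domain:
  fixes M :: "real^'n^'n"
  shows "(\<lambda>t. t v* M) ` half_box \<in> lmeasurable"
    and "measure lebesgue ((\<lambda>t. t v* M) ` half_box) = \<bar>det M\<bar>"
proof -
  have eq: "(\<lambda>t. t v* M) = (*v) (transpose M)" by (simp add: fun_eq_iff)
  have "volume_by_det (\<lambda>t. t v* M)"
    unfolding eq by (intro volume_by_det_linear matrix_vector_mul_linear)
  moreover have "matrix (\<lambda>t. t v* M) = transpose M"
    unfolding eq by (rule matrix_of_matrix_vector_mul)
  ultimately show "(\<lambda>t. t v* M) ` half_box \<in> lmeasurable"
    "measure lebesgue ((\<lambda>t. t v* M) ` half_box) = \<bar>det M\<bar>"
    using half_box_lmeasurable by (auto simp: volume_by_det_def measure_half_box det_transpose)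
qed

lemma row_action_eq_0:
  fixes M :: "real^'n^'n"
  assumes "det M \<noteq> 0" "c v* M = 0"
  shows "c = 0"
proof -
  have "c $ k * det M = 0" for k
  proof -
    have "c $ k * det M = det (\<chi> i. if i = k then c v* M else row i M)"
      by (rule cramer_rows[symmetric])
    also have "\<dots> = 0"
      by (rule det_zero_row(1)[of k]) (simp add: row_def assms(2) zero_vec_def)
    finally show ?thesis .
  qed
  then show ?thesis using assms(1) by (simp add: vec_eq_iff)
qed

lemma fundamental_domain_packing:
  fixes M :: "real^'n^'n"
  assumes "det M \<noteq> 0" "x \<in> (\<lambda>t. t v* M) ` half_box" "y \<in> (\<lambda>t. t v* M) ` half_box"
    "c \<in> Zvec" "x - y = c v* M"
  shows "c = 0"
proof -
  obtain t u where tu: "t \<in> half_box" "u \<in> half_box" "x = t v* M" "y = u v* M"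
    using assms by auto
  have "(t - u - c) v* M = 0"
    using assms(5) tu by (simp add: vector_matrix_mult_diff_distrib)
  then have c: "t - u - c = 0" using row_action_eq_0 assms(1) by blast
  then have "t = u" using half_box_unique[OF tu(1,2)] assms(4) by simp
  then show ?thesis using c by simp
qed

lemma fundamental_domain_covering:
  fixes M :: "real^'n^'n"
  assumes "det M \<noteq> 0"
  shows "\<exists>c\<in>Zvec. x - c v* M \<in> (\<lambda>t. t v* M) ` half_box"
proof -
  obtain t where t: "t v* M = x" using row_action_surj[OF assms] .
  let ?c = "(\<chi> i. of_int \<lfloor>t $ i\<rfloor>) :: real^'n"
  have "?c \<in> Zvec" by (simp add: Zvec_def)
  moreover have "x - ?c v* M = (t - ?c) v* M"
    by (simp add: vector_matrix_mult_diff_distrib t)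
  then have "x - ?c v* M \<in> (\<lambda>t. t v* M) ` half_box"
    using half_box_floor[of t] by blast
  ultimately show ?thesis by blast
qed

section \<open>Counting integer points and cosets by volume\<close>

definition cubes :: "(real^'n) set \<Rightarrow> (real^'n) set" where
  "cubes B = (\<Union>z\<in>B. (+) z ` half_box)"

lemma mem_cubes: "x \<in> cubes B \<longleftrightarrow> (\<exists>z\<in>B. x - z \<in> half_box)"
  by (force simp: cubes_def image_iff algebra_simps)

lemma cubes_lmeasurable: "finite B \<Longrightarrow> cubes B \<in> lmeasurable"
  unfolding cubes_def by (intro fmeasurable.finite_UN measurable_translation half_box_lmeasurable)

lemma measure_cubes:
  fixes B :: "(real^'n) set"
  assumes "finite B" "B \<subseteq> Zvec"
  shows "measure lebesgue (cubes B) = real (card B)"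
proof -
  have "disjoint_family_on (\<lambda>z. (+) z ` half_box) B"
  proof (clarsimp simp: disjoint_family_on_def)
    fix y z assume yz: "y \<in> B" "z \<in> B" "y \<noteq> z"
    have False if "u \<in> half_box" "w \<in> half_box" "y + u = z + w" for u w
    proof -
      have "u - w = z - y" using that(3) by (simp add: algebra_simps)
      moreover have "z - y \<in> Zvec" using yz assms by (auto intro!: Zvec_diff)
      ultimately have "u = w" using half_box_unique that by metis
      then show False using yz that by simp
    qed
    then show "(+) y ` half_box \<inter> (+) z ` half_box = {}" by blast
  qed
  then have "measure lebesgue (cubes B) = (\<Sum>z\<in>B. measure lebesgue ((+) z ` half_box))"
    unfolding cubes_def using assms(1) measurable_translation[OF half_box_lmeasurable]
    by (intro measure_finite_Union) (auto intro: fmeasurableD dest!: fmeasurableD2 simp del: emeasure_completion)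
  then show ?thesis by (simp add: measure_translation measure_half_box)
qed

text \<open>Cubes at inequivalent integer points pack modulo the lattice and the parallelepiped of
  \<open>M\<close> covers, so \<open>packing_le_covering\<close> compares their volumes.\<close>

lemma inequivalent_card_le_det:
  fixes M :: "real^'n^'n"
  assumes M: "det M \<noteq> 0" "\<And>i. M $ i \<in> Zvec" and B: "finite B" "B \<subseteq> Zvec"
    and ineq: "\<And>x y. x \<in> B \<Longrightarrow> y \<in> B \<Longrightarrow> x - y \<in> row_lattice M \<Longrightarrow> x = y"
  shows "real (card B) \<le> \<bar>det M\<bar>"
proof -
  have "measure lebesgue (cubes B) \<le> measure lebesgue ((\<lambda>t. t v* M) ` half_box)"
  proof (rule packing_le_covering)
    fix x y c assume xy: "x \<in> cubes B" "y \<in> cubes B" and c: "c \<in> Zvec" "x - y = c v* M"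
    obtain z w where zw: "z \<in> B" "x - z \<in> half_box" "w \<in> B" "y - w \<in> half_box"
      using xy by (auto simp: mem_cubes)
    \<comment> \<open>Since \<open>M\<close> is integral, the two positions within their cubes
      differ by an integer vector and therefore coincide.\<close>
    have "(x - z) - (y - w) = c v* M - (z - w)" using c(2) by (simp add: algebra_simps)
    moreover have "c v* M \<in> Zvec" using c(1) M(2) by (rule Zvec_mult_matrix)
    moreover have "z - w \<in> Zvec" using zw B(2) by (auto intro!: Zvec_diff)
    ultimately have "(x - z) - (y - w) \<in> Zvec" by (simp only: Zvec_diff)
    then have *: "x - z = y - w" using half_box_unique zw by blast
    then have "z - w = c v* M" using c(2) by (simp add: algebra_simps)
    then have "z = w" using ineq zw c(1) by (auto simp: row_lattice_eq)
    then have "c v* M = 0" using \<open>z - w = c v* M\<close> by simp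
    then show "c = 0" using row_action_eq_0 M(1) by blast
  qed (use fundamental_domain cubes_lmeasurable B fundamental_domain_covering M in auto)
  then show ?thesis by (simp add: measure_cubes B fundamental_domain(2))
qed

text \<open>The same comparison with the roles exchanged: a lattice vector that moves the floor of a
  point into \<open>B\<close> moves the point itself into a cube.\<close>

lemma det_le_covering_card:
  fixes M :: "real^'n^'n"
  assumes M: "det M \<noteq> 0" and B: "finite B" "B \<subseteq> Zvec"
    and cover: "translates_cover Zvec B (row_lattice M)"
  shows "\<bar>det M\<bar> \<le> real (card B)"
proof -
  have "measure lebesgue ((\<lambda>t. t v* M) ` half_box) \<le> measure lebesgue (cubes B)"
  proof (rule packing_le_covering)
    fix x :: "real^'n"
    let ?z = "(\<chi> i. of_int \<lfloor>x $ i\<rfloor>) :: real^'n"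
    have "?z \<in> Zvec" by (simp add: Zvec_def)
    then obtain c where c: "c \<in> Zvec" "?z - c v* M \<in> B"
      using cover unfolding translates_cover_row_lattice by blast
    have "(x - c v* M) - (?z - c v* M) \<in> half_box" using half_box_floor[of x] by simp
    then show "\<exists>c\<in>Zvec. x - c v* M \<in> cubes B" using c mem_cubes by blast
  qed (use fundamental_domain cubes_lmeasurable B fundamental_domain_packing M in blast)+
  then show ?thesis by (simp add: measure_cubes B fundamental_domain(2))
qed

text \<open>A system of coset representatives is both inequivalent and covering, so the determinant
  bounds its size from both sides.\<close>

lemma int_index_eq_det:
  fixes M :: "real^'n^'n"
  assumes M: "det M \<noteq> 0" "\<And>i. M $ i \<in> Zvec"
  shows "real (int_index (row_lattice M)) = \<bar>det M\<bar>"
proof -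
  let ?L = "row_lattice M"
  define R where "R = {(x, y). x \<in> (Zvec :: (real^'n) set) \<and> y \<in> Zvec \<and> x - y \<in> ?L}"
  have L0: "0 \<in> ?L" using Zvec_0 unfolding row_lattice_eq by force
  have neg: "y - x \<in> ?L" if "x - y \<in> ?L" for x y
    using row_lattice_diff[OF L0 that] by simp
  have equiv: "equiv Zvec R"
  proof (rule equivI)
    show "refl_on Zvec R" using L0 by (auto simp: refl_on_def R_def)
    show "R \<subseteq> Zvec \<times> Zvec" by (auto simp: R_def)
    show "sym R"
    proof (rule symI)
      fix x y assume "(x, y) \<in> R"
      then show "(y, x) \<in> R" using neg[of x y] by (simp add: R_def)
    qed
    show "trans R"
    proof (rule transI)
      fix x y z assume xyz: "(x, y) \<in> R" "(y, z) \<in> R"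
      then have "x - y \<in> ?L" "z - y \<in> ?L" using neg[of y z] by (auto simp: R_def)
      then have "(x - y) - (z - y) \<in> ?L" by (rule row_lattice_diff)
      then show "(x, z) \<in> R" using xyz by (auto simp: R_def)
    qed
  qed
  define rep where "rep X = (SOME x. x \<in> X)" for X :: "(real^'n) set"
  have rep: "rep X \<in> X" if "X \<in> Zvec // R" for X
    using in_quotient_imp_non_empty[OF equiv that] by (simp add: rep_def some_in_eq)
  have repZ: "rep X \<in> Zvec" if "X \<in> Zvec // R" for X
    using rep[OF that] in_quotient_imp_subset[OF equiv that] by auto
  have eq: "X = Y" if "X \<in> Zvec // R" "Y \<in> Zvec // R" "rep X - rep Y \<in> ?L" for X Y
  proof -
    have "(rep X, rep Y) \<in> R" using that repZ by (auto simp: R_def)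
    then show ?thesis using quotient_eqI[OF equiv that(1,2) rep[OF that(1)] rep[OF that(2)]] by simp
  qed
  have bound: "real (card (rep ` G)) \<le> \<bar>det M\<bar>" "card (rep ` G) = card G"
    if "G \<subseteq> Zvec // R" "finite G" for G
  proof -
    show "real (card (rep ` G)) \<le> \<bar>det M\<bar>"
    proof (rule inequivalent_card_le_det[OF M])
      show "finite (rep ` G)" using that by simp
      show "rep ` G \<subseteq> Zvec" using that repZ by blast
      fix x y assume "x \<in> rep ` G" "y \<in> rep ` G" and xy: "x - y \<in> ?L"
      then obtain X Y where "X \<in> G" "Y \<in> G" "x = rep X" "y = rep Y" by blast
      then show "x = y" using eq[of X Y] that xy by auto
    qed
    show "card (rep ` G) = card G"
    proof (rule card_image, rule inj_onI)
      fix X Y assume "X \<in> G" "Y \<in> G" "rep X = rep Y"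
      then show "X = Y" using eq[of X Y] L0 that by auto
    qed
  qed
  \<comment> \<open>An infinite quotient would have \<open>card\<close> 0, so finiteness comes
    first; it follows from the common bound on finite sets of cosets.\<close>
  have fin: "finite (Zvec // R)"
  proof -
    have "card G \<le> nat \<lceil>\<bar>det M\<bar>\<rceil>" if "G \<subseteq> Zvec // R" "finite G" for G
      using bound[OF that] by linarith
    then show ?thesis using finite_if_finite_subsets_card_bdd by blast
  qed
  have "\<bar>det M\<bar> \<le> real (card (rep ` (Zvec // R)))"
  proof (rule det_le_covering_card)
    show "translates_cover Zvec (rep ` (Zvec // R)) ?L"
      unfolding translates_cover_def
    proof
      fix z :: "real^'n" assume z: "z \<in> Zvec"
      let ?X = "R `` {z}"
      have X: "?X \<in> Zvec // R" using z by (rule quotientI)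
      have "z - rep ?X \<in> ?L" using rep[OF X] by (auto simp: R_def)
      then show "z \<in> (\<Union>v\<in>?L. (\<lambda>x. x + v) ` rep ` (Zvec // R))"
        using X by (intro UN_I[of "z - rep ?X"]) (auto intro!: image_eqI[of _ _ "rep ?X"])
    qed
  qed (use fin repZ M in auto)
  then show ?thesis
    using bound[OF order_refl fin] unfolding int_index_def R_def[symmetric] by simp
qed

section \<open>Scaling, continuity and diagonal dominance\<close>

lemma det_scaleR:
  fixes M :: "real^'n^'n"
  shows "det (r *\<^sub>R M) = r ^ CARD('n) * det M"
  unfolding det_def by (simp add: prod.distrib sum_distrib_left mult_ac)

lemma row_action_scaleR: "c v* (r *\<^sub>R M) = r *\<^sub>R (c v* (M :: real^'n^'m))"
  by (simp add: vec_eq_iff vector_matrix_mult_def sum_distrib_left mult_ac)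

lemma continuous_on_det: "continuous_on X (det :: real^'n^'n \<Rightarrow> real)"
  unfolding det_def by (intro continuous_intros)

lemma continuous_on_row_action: "continuous_on X (\<lambda>M. c v* (M :: real^'n^'m))"
  unfolding vector_matrix_mult_def by (intro continuous_intros)

text \<open>At a coordinate of largest absolute value, a nonzero kernel vector would need an
  absolute row sum of \<open>R\<close> of at least \<open>r\<close>.\<close>

lemma strictly_dominant_det_nonzero:
  fixes R :: "real^'n^'n"
  assumes "\<And>i. (\<Sum>j\<in>UNIV. \<bar>R $ i $ j\<bar>) < r"
  shows "det (mat r - R) \<noteq> 0"
proof -
  have "x = 0" if x: "(mat r - R) *v x = 0" for x
  proof -
    have "Max (range (\<lambda>i. \<bar>x $ i\<bar>)) \<in> range (\<lambda>i. \<bar>x $ i\<bar>)"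
      by (rule Max_in) auto
    then obtain i where "Max (range (\<lambda>i. \<bar>x $ i\<bar>)) = \<bar>x $ i\<bar>" by blast
    then have max: "\<bar>x $ j\<bar> \<le> \<bar>x $ i\<bar>" for j by (metis Max_ge finite finite_imageI rangeI)
    have "r * x $ i = (\<Sum>j\<in>UNIV. R $ i $ j * x $ j)"
      using x by (auto simp: vec_eq_iff matrix_vector_mult_def mat_def left_diff_distrib sum_subtractf
          if_distrib[of "\<lambda>y. y * _"] cong: if_cong)
    then have "r * \<bar>x $ i\<bar> \<le> \<bar>\<Sum>j\<in>UNIV. R $ i $ j * x $ j\<bar>"
      by (metis abs_ge_self abs_ge_zero abs_mult mult_right_mono)
    also have "\<dots> \<le> (\<Sum>j\<in>UNIV. \<bar>R $ i $ j\<bar> * \<bar>x $ j\<bar>)"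
      by (metis (no_types, lifting) abs_mult sum_abs sum.cong)
    also have "\<dots> \<le> (\<Sum>j\<in>UNIV. \<bar>R $ i $ j\<bar> * \<bar>x $ i\<bar>)"
      by (intro sum_mono mult_left_mono max) auto
    finally have "r * \<bar>x $ i\<bar> \<le> (\<Sum>j\<in>UNIV. \<bar>R $ i $ j\<bar>) * \<bar>x $ i\<bar>"
      by (simp only: sum_distrib_right)
    with assms[of i] have "\<bar>x $ i\<bar> = 0"
      by (smt (verit, best) abs_ge_zero mult_less_cancel_right_pos zero_less_abs_iff)
    then show "x = 0" using max by (simp add: vec_eq_iff)
  qed
  then have "\<exists>B. B ** (mat r - R) = mat 1"
    unfolding matrix_left_invertible_ker by blast
  then show ?thesis using invertible_det_nz invertible_left_inverse by blast
qed

section \<open>Big-O estimates\<close>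

lemma bigo_cmult:
  fixes f g :: "nat \<Rightarrow> real"
  assumes "f \<in> O(g)"
  shows "(\<lambda>k. c * f k) \<in> O(g)"
  using assms by (cases "c = 0") simp_all

lemma ratio_power_bigo:
  fixes a b :: real
  shows "(\<lambda>k::nat. ((real k + a) / (real k + b)) ^ m - 1) \<in> O(\<lambda>k. 1 / real k)"
proof (induction m)
  case (Suc m)
  let ?r = "\<lambda>k::nat. (real k + a) / (real k + b)"
  have "(\<lambda>k::nat. 1 / (real k + b)) \<in> O(\<lambda>k. 1 / real k)" by real_asymp
  then have scaled: "(\<lambda>k::nat. (a - b) * (1 / (real k + b))) \<in> O(\<lambda>k. 1 / real k)" by (rule bigo_cmult)
  have "eventually (\<lambda>k::nat. (a - b) * (1 / (real k + b)) = ?r k - 1) at_top"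
  proof (rule eventually_mono)
    show "eventually (\<lambda>k::nat. real k + b > 0) at_top" by real_asymp
    fix k :: nat assume k: "real k + b > 0"
    have "?r k - (real k + b) / (real k + b) = (a - b) * (1 / (real k + b))"
      by (simp only: diff_divide_distrib[symmetric]) simp
    then show "(a - b) * (1 / (real k + b)) = ?r k - 1" using k by simp
  qed
  from landau_o.big.in_cong[OF this] have r: "(\<lambda>k. ?r k - 1) \<in> O(\<lambda>k. 1 / real k)"
    by (rule iffD1) (rule scaled)
  have "(\<lambda>k::nat. 1 / real k) \<in> O(\<lambda>_. 1)" by real_asymp
  then have "(\<lambda>k. ?r k ^ m - 1) \<in> O(\<lambda>_. 1)" by (rule landau_o.big_trans[OF Suc.IH])
  then have "(\<lambda>k. (?r k ^ m - 1) + 1) \<in> O(\<lambda>_. 1)" by (rule sum_in_bigo(1)) simp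
  from landau_o.big.mult[OF this r]
  have "(\<lambda>k. ((?r k ^ m - 1) + 1) * (?r k - 1)) \<in> O(\<lambda>k. 1 / real k)"
    by (simp only: mult_1)
  from sum_in_bigo(1)[OF this Suc.IH]
  have "(\<lambda>k. ((?r k ^ m - 1) + 1) * (?r k - 1) + (?r k ^ m - 1)) \<in> O(\<lambda>k. 1 / real k)" .
  \<comment> \<open>Peeling off one factor: the bracket with \<open>+ 1\<close> stays bounded, and
    both differences are of order \<open>1 / k\<close>.\<close>
  moreover have "((?r k ^ m - 1) + 1) * (?r k - 1) + (?r k ^ m - 1) = ?r k ^ Suc m - 1" for k
    by (simp only: power_Suc) algebra
  ultimately show ?case by (simp only:)
qed simp

lemma bigo_sandwich:
  fixes f g h :: "nat \<Rightarrow> real"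
  assumes "eventually (\<lambda>k. g k \<le> f k \<and> f k \<le> h k) at_top" "g \<in> O(u)" "h \<in> O(u)"
  shows "f \<in> O(u)"
proof -
  have "(\<lambda>k. \<bar>g k\<bar> + \<bar>h k\<bar>) \<in> O(u)"
    using assms(2,3) by (intro sum_in_bigo) simp_all
  moreover have "f \<in> O(\<lambda>k. \<bar>g k\<bar> + \<bar>h k\<bar>)"
    by (rule landau_o.big_mono, rule eventually_mono[OF assms(1)]) auto
  ultimately show ?thesis by (rule landau_o.big_trans[rotated])
qed

subsection \<open>Coverings by dilates of a body\<close>

text \<open>The common ground of cross-polytope and simplex. \<open>enlarge\<close> takes only
  nonnegative \<open>u\<close>, since otherwise the simplex would be left; the slack in
  \<open>floor_mem\<close> serves the cross-polytope, where rounding down can increase absolute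
  values. \<open>sum_abs_le\<close> gives boundedness and, at radius 1, diagonal dominance.\<close>

locale lattice_covering_body =
  fixes A :: "real \<Rightarrow> (real^'n) set"
  assumes scale: "s > 0 \<Longrightarrow> A s = (*\<^sub>R) s ` A 1"
    and enlarge: "0 \<le> s \<Longrightarrow> 0 \<le> c \<Longrightarrow> x \<in> A s \<Longrightarrow> (\<And>i. 0 \<le> u $ i \<and> u $ i \<le> c) \<Longrightarrow> x + u \<in> A (s + real CARD('n) * c)"
    and zero_mem: "0 \<in> A 0"
    and floor_mem: "x \<in> A s \<Longrightarrow> (\<chi> i. of_int \<lfloor>x $ i\<rfloor>) \<in> A (s + real CARD('n))"
    and closed: "closed (A s)"
    and sum_abs_le: "x \<in> A s \<Longrightarrow> (\<Sum>i\<in>UNIV. \<bar>x $ i\<bar>) \<le> s"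
begin

abbreviation vol where "vol \<equiv> measure lebesgue (A 1)"

lemma component_le: "x \<in> A s \<Longrightarrow> \<bar>x $ i\<bar> \<le> s"
  using sum_abs_le[of x s] member_le_sum[of i UNIV "\<lambda>i. \<bar>x $ i\<bar>"] by force

lemma A_lmeasurable: "A s \<in> lmeasurable"
proof -
  have "bounded (A s)"
    unfolding bounded_iff using sum_abs_le norm_le_l1_cart order_trans by blast
  then show ?thesis
    using closed by (simp add: compact_eq_bounded_closed lmeasurable_compact)
qed

lemma scale_mem: "s > 0 \<Longrightarrow> x \<in> A 1 \<Longrightarrow> s *\<^sub>R x \<in> A s"
  using scale[of s] by auto

lemma unscale_mem:
  assumes "s > 0" "x \<in> A s"
  shows "(1 / s) *\<^sub>R x \<in> A 1"
  using assms scale[of s] by auto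

lemma measure_A: "s > 0 \<Longrightarrow> measure lebesgue (A s) = s ^ CARD('n) * vol"
  using measure_lebesgue_affine[of s 0 "A 1"] scale[of s] by simp

lemma vol_pos: "vol > 0"
proof -
  have "half_box \<subseteq> A (real CARD('n))"
  proof
    fix u :: "real^'n" assume "u \<in> half_box"
    then have "0 + u \<in> A (0 + real CARD('n) * 1)"
      by (intro enlarge zero_mem) (auto simp: half_box_def less_imp_le)
    then show "u \<in> A (real CARD('n))" by simp
  qed
  then have "measure lebesgue (half_box :: (real^'n) set) \<le> measure lebesgue (A (real CARD('n)))"
    by (rule measure_mono_fmeasurable) (use half_box_lmeasurable A_lmeasurable in auto)
  then have "1 \<le> real CARD('n) ^ CARD('n) * vol"
    by (simp add: measure_half_box measure_A[of "real CARD('n)"])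
  then show ?thesis
    by (smt (verit) mult_nonneg_nonpos of_nat_0_le_iff zero_le_power)
qed

lemma finite_A_Zvec: "finite (A s \<inter> Zvec)"
  by (rule finite_bounded_Zvec) (rule component_le)

text \<open>Cubes at the integer points of \<open>A s\<close> stay inside the body whose radius is
  larger by the dimension. With \<open>card_ge\<close>, the count is the volume up to a relative
  error of order \<open>1 / s\<close>.\<close>

lemma card_le:
  assumes "s \<ge> 0"
  shows "real (card (A s \<inter> Zvec)) \<le> (s + real CARD('n)) ^ CARD('n) * vol"
proof -
  have "cubes (A s \<inter> Zvec) \<subseteq> A (s + real CARD('n))"
  proof
    fix x assume "x \<in> cubes (A s \<inter> Zvec)"
    then obtain z where z: "z \<in> A s" "x - z \<in> half_box" unfolding mem_cubes by blast
    have "z + (x - z) \<in> A (s + real CARD('n) * 1)"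
      by (rule enlarge) (use assms z in \<open>auto simp: half_box_def less_imp_le\<close>)
    then show "x \<in> A (s + real CARD('n))" by simp
  qed
  then have "measure lebesgue (cubes (A s \<inter> Zvec)) \<le> measure lebesgue (A (s + real CARD('n)))"
    by (rule measure_mono_fmeasurable) (use cubes_lmeasurable finite_A_Zvec A_lmeasurable in auto)
  then show ?thesis
    using assms by (simp add: measure_cubes finite_A_Zvec measure_A[of "s + real CARD('n)"] add_nonneg_pos)
qed

lemma card_ge:
  assumes "s > real CARD('n)"
  shows "(s - real CARD('n)) ^ CARD('n) * vol \<le> real (card (A s \<inter> Zvec))"
proof -
  have "A (s - real CARD('n)) \<subseteq> cubes (A s \<inter> Zvec)"
  proof
    fix x assume "x \<in> A (s - real CARD('n))"
    from floor_mem[OF this] have "(\<chi> i. of_int \<lfloor>x $ i\<rfloor>) \<in> A s \<inter> Zvec"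
      by (simp add: Zvec_def)
    then show "x \<in> cubes (A s \<inter> Zvec)"
      using half_box_floor[of x] unfolding mem_cubes by blast
  qed
  then have "measure lebesgue (A (s - real CARD('n))) \<le> measure lebesgue (cubes (A s \<inter> Zvec))"
    by (rule measure_mono_fmeasurable) (use cubes_lmeasurable finite_A_Zvec A_lmeasurable in auto)
  then show ?thesis
    using assms by (simp add: measure_cubes finite_A_Zvec measure_A[of "s - real CARD('n)"])
qed

section \<open>Existence of an optimal real covering\<close>

abbreviation covering :: "real^'n^'n \<Rightarrow> bool" where
  "covering M \<equiv> translates_cover UNIV (A 1) (row_lattice M)"

text \<open>For each \<open>i\<close> the covering provides a lattice vector that differs from twice
  the unit vector by a point of \<open>A 1\<close>. The absolute row sums of \<open>R\<close> are at
  most 1, below the diagonal 2, so these vectors are independent, with entries at most 3. Comparing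
  their determinant with \<open>\<delta>\<close> bounds the number of exchanges independently of
  \<open>M\<close>.\<close>

lemma covering_bounded_basis:
  assumes \<delta>: "\<delta> > 0"
  shows "\<exists>K. \<forall>M. covering M \<and> \<delta> \<le> \<bar>det M\<bar> \<longrightarrow>
    (\<exists>B. row_lattice B = row_lattice M \<and> \<bar>det B\<bar> = \<bar>det M\<bar> \<and> (\<forall>i j. \<bar>B $ i $ j\<bar> \<le> K))"
proof -
  let ?C = "fact CARD('n) * 3 ^ CARD('n) :: real"
  obtain m where m: "?C / \<delta> < 2 ^ m" using real_arch_pow[of 2 "?C / \<delta>"] by auto
  have "\<exists>B. row_lattice B = row_lattice M \<and> \<bar>det B\<bar> = \<bar>det M\<bar> \<and>
      (\<forall>i j. \<bar>B $ i $ j\<bar> \<le> real CARD('n) ^ m * 3)" if M: "covering M" "\<delta> \<le> \<bar>det M\<bar>" for M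
  proof -
    have "\<forall>i. \<exists>c\<in>Zvec. axis i 2 - c v* M \<in> A 1"
      using M(1) unfolding translates_cover_row_lattice by blast
    then obtain c where c: "\<And>i. c i \<in> Zvec" "\<And>i. axis i 2 - c i v* M \<in> A 1" by metis
    define R where "R = (\<chi> i. axis i 2 - c i v* M)"
    define V where "V = mat 2 - R"
    have V: "V $ i = c i v* M" for i
      by (simp add: V_def R_def vec_eq_iff mat_def axis_def eq_commute)
    have R: "R $ i \<in> A 1" for i by (simp add: R_def c)
    have "det V \<noteq> 0"
      unfolding V_def
      by (rule strictly_dominant_det_nonzero) (rule le_less_trans[OF sum_abs_le[OF R]], simp)
    moreover have "V $ i \<in> row_lattice M" for i
      using c(1) unfolding V row_lattice_eq by blast
    moreover have V3: "\<bar>V $ i $ j\<bar> \<le> 3" for i j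
      using component_le[OF R, of i j] by (auto simp: V_def mat_def)
    moreover have "\<bar>det V\<bar> < 2 ^ m * \<bar>det M\<bar>"
    proof -
      have "\<bar>det V\<bar> \<le> ?C" by (rule det_abs_le) (rule V3)
      also have "\<dots> < 2 ^ m * \<delta>" using m \<delta> by (simp add: field_simps)
      also have "\<dots> \<le> 2 ^ m * \<bar>det M\<bar>" using M by simp
      finally show ?thesis .
    qed
    ultimately show ?thesis by (rule bounded_lattice_basis)
  qed
  then show ?thesis by blast
qed

text \<open>For fixed \<open>x\<close>, being covered is a union of closed conditions over all
  integer \<open>c\<close>. Cramer's rule leaves only the finite set \<open>Cs x\<close>, the same
  for all matrices in \<open>?R\<close>, so the union is closed.\<close>

lemma compact_bounded_coverings:
  assumes \<delta>: "\<delta> > 0" and K: "K \<ge> 0"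
  shows "compact {M. (\<forall>i j. \<bar>M $ i $ j\<bar> \<le> K) \<and> \<delta> \<le> \<bar>det M\<bar> \<and> covering M}"
proof -
  let ?R = "{M :: real^'n^'n. (\<forall>i j. \<bar>M $ i $ j\<bar> \<le> K) \<and> \<delta> \<le> \<bar>det M\<bar>}"
  \<comment> \<open>\<open>K + norm x + 1\<close> bounds the entries of \<open>M\<close> and also
    those of \<open>c v* M\<close>, which differs from \<open>x\<close> by a point of
    \<open>A 1\<close>.\<close>
  define b where "b x = fact CARD('n) * (K + norm x + 1) ^ CARD('n) / \<delta>" for x :: "real^'n"
  define Cs where "Cs x = {c :: real^'n. \<forall>i. \<bar>c $ i\<bar> \<le> b x} \<inter> Zvec" for x :: "real^'n"
  have fin: "finite (Cs x)" for x
    unfolding Cs_def by (rule finite_bounded_Zvec[where K="b x"]) auto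
  have Cs: "c \<in> Cs x" if M: "M \<in> ?R" and c: "c \<in> Zvec" "x - c v* M \<in> A 1" for M and c x :: "real^'n"
  proof -
    have "\<bar>c $ i\<bar> \<le> b x" for i
      unfolding b_def
    proof (rule cramer_bound)
      show "\<bar>M $ i $ j\<bar> \<le> K + norm x + 1" for i j
      proof -
        have "\<bar>M $ i $ j\<bar> \<le> K" using M by simp
        then show ?thesis using norm_ge_zero[of x] by linarith
      qed
      show "\<bar>(c v* M) $ j\<bar> \<le> K + norm x + 1" for j
        using component_le[OF c(2), of j] component_le_norm_cart[of x j] K by simp
    qed (use M \<delta> in auto)
    then show ?thesis using c by (simp add: Cs_def)
  qed
  have "{M. (\<forall>i j. \<bar>M $ i $ j\<bar> \<le> K) \<and> \<delta> \<le> \<bar>det M\<bar> \<and> covering M}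
      = ?R \<inter> (\<Inter>x. \<Union>c\<in>Cs x. (\<lambda>M. x - c v* M) -` A 1)"
  proof (rule set_eqI)
    fix M
    have "(\<exists>c\<in>Zvec. x - c v* M \<in> A 1) \<longleftrightarrow> (\<exists>c\<in>Cs x. x - c v* M \<in> A 1)" if "M \<in> ?R" for x
      using Cs[OF that] unfolding Cs_def by blast
    then show "M \<in> {M. (\<forall>i j. \<bar>M $ i $ j\<bar> \<le> K) \<and> \<delta> \<le> \<bar>det M\<bar> \<and> covering M}
        \<longleftrightarrow> M \<in> ?R \<inter> (\<Inter>x. \<Union>c\<in>Cs x. (\<lambda>M. x - c v* M) -` A 1)"
      unfolding translates_cover_row_lattice by simp blast
  qed
  moreover have "closed ((\<lambda>M. x - c v* M) -` A 1)" for x c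
    by (intro closed_vimage closed continuous_intros continuous_on_row_action)
  then have "closed (\<Inter>x. \<Union>c\<in>Cs x. (\<lambda>M. x - c v* M) -` A 1)"
    using fin by blast
  moreover have "compact ?R"
  proof -
    have "norm M \<le> real CARD('n) * (real CARD('n) * K)" if "M \<in> ?R" for M
    proof -
      have "norm M \<le> (\<Sum>i\<in>UNIV. norm (M $ i))"
        unfolding norm_vec_def by (rule L2_set_le_sum) simp
      also have "\<dots> \<le> (\<Sum>i\<in>(UNIV::'n set). real CARD('n) * K)"
      proof (rule sum_mono)
        fix i
        have "norm (M $ i) \<le> (\<Sum>j\<in>UNIV. \<bar>M $ i $ j\<bar>)" by (rule norm_le_l1_cart)
        also have "\<dots> \<le> (\<Sum>j\<in>(UNIV::'n set). K)" by (rule sum_mono) (use that in auto)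
        finally show "norm (M $ i) \<le> real CARD('n) * K" by simp
      qed
      finally show ?thesis by simp
    qed
    then have "bounded ?R" unfolding bounded_iff by blast
    moreover have "closed ?R"
      by (intro closed_Collect_conj closed_Collect_all closed_Collect_le
          continuous_on_rabs continuous_on_component continuous_on_id continuous_on_const continuous_on_det)
    ultimately show ?thesis by (simp add: compact_eq_bounded_closed)
  qed
  ultimately show ?thesis by (simp add: compact_Int_closed)
qed

text \<open>The cubic lattice whose mesh is the reciprocal of the dimension works: by
  \<open>enlarge\<close> from 0, a cube of that side fits into \<open>A 1\<close>.\<close>

lemma covering_exists: "\<exists>M. covering M \<and> det M \<noteq> 0"
proof (intro exI conjI)
  let ?M = "(1 / real CARD('n)) *\<^sub>R (mat 1 :: real^'n^'n)"
  show "det ?M \<noteq> 0" by (simp add: det_scaleR)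
  have "x - (\<chi> i. of_int \<lfloor>real CARD('n) * x $ i\<rfloor>) v* ?M \<in> A 1" for x
  proof -
    have "0 + (x - (\<chi> i. of_int \<lfloor>real CARD('n) * x $ i\<rfloor>) v* ?M) \<in> A (0 + real CARD('n) * (1 / real CARD('n)))"
    proof (rule enlarge)
      show "0 \<le> (x - (\<chi> i. of_int \<lfloor>real CARD('n) * x $ i\<rfloor>) v* ?M) $ i \<and>
          (x - (\<chi> i. of_int \<lfloor>real CARD('n) * x $ i\<rfloor>) v* ?M) $ i \<le> 1 / real CARD('n)" for i
      proof -
        have "(x - (\<chi> i. of_int \<lfloor>real CARD('n) * x $ i\<rfloor>) v* ?M) $ i
            = (real CARD('n) * x $ i - of_int \<lfloor>real CARD('n) * x $ i\<rfloor>) / real CARD('n)"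
          by (simp add: row_action_scaleR diff_divide_distrib)
        moreover have "0 \<le> real CARD('n) * x $ i - of_int \<lfloor>real CARD('n) * x $ i\<rfloor>"
          "real CARD('n) * x $ i - of_int \<lfloor>real CARD('n) * x $ i\<rfloor> \<le> 1"
          by linarith+
        ultimately show ?thesis by (simp add: divide_right_mono)
      qed
    qed (use zero_mem in auto)
    then show ?thesis by simp
  qed
  then show "covering ?M"
    unfolding translates_cover_row_lattice
    by (intro ballI bexI[of _ "\<chi> i. of_int \<lfloor>real CARD('n) * _ $ i\<rfloor>"]) (auto simp: Zvec_def)
qed

text \<open>A lattice with determinant below that of one known covering cannot be better, which
  supplies \<open>\<delta>\<close>. Passing to a bounded basis keeps lattice and determinant, so a
  maximum over the compact \<open>T\<close> is a maximum over all coverings.\<close>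

lemma optimal_covering:
  "\<exists>M. covering M \<and> det M \<noteq> 0 \<and> (\<forall>M'. covering M' \<longrightarrow> \<bar>det M'\<bar> \<le> \<bar>det M\<bar>)"
proof -
  obtain M0 where M0: "covering M0" "det M0 \<noteq> 0" using covering_exists by blast
  define \<delta> where "\<delta> = \<bar>det M0\<bar>"
  have \<delta>: "\<delta> > 0" using M0(2) by (simp add: \<delta>_def)
  from covering_bounded_basis[OF \<delta>] obtain K where K: "\<forall>M. covering M \<and> \<delta> \<le> \<bar>det M\<bar> \<longrightarrow>
      (\<exists>B. row_lattice B = row_lattice M \<and> \<bar>det B\<bar> = \<bar>det M\<bar> \<and> (\<forall>i j. \<bar>B $ i $ j\<bar> \<le> K))" ..
  define T where "T = {M. (\<forall>i j. \<bar>M $ i $ j\<bar> \<le> K) \<and> \<delta> \<le> \<bar>det M\<bar> \<and> covering M}"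
  have into_T: "\<exists>B\<in>T. \<bar>det B\<bar> = \<bar>det M\<bar>" if M: "covering M" "\<delta> \<le> \<bar>det M\<bar>" for M
  proof -
    from K[rule_format, OF conjI[OF M]] obtain B where B: "row_lattice B = row_lattice M \<and>
        \<bar>det B\<bar> = \<bar>det M\<bar> \<and> (\<forall>i j. \<bar>B $ i $ j\<bar> \<le> K)" ..
    then have "B \<in> T" using M by (simp add: T_def)
    then show ?thesis using B by (intro bexI[of _ B]) simp_all
  qed
  have "\<delta> \<le> \<bar>det M0\<bar>" by (simp add: \<delta>_def)
  from into_T[OF M0(1) this] obtain B0 where B0: "B0 \<in> T" ..
  have "0 \<le> \<bar>B0 $ undefined $ undefined\<bar>" by simp
  also have "\<dots> \<le> K" using B0 by (simp add: T_def)
  finally have "compact T" unfolding T_def by (rule compact_bounded_coverings[OF \<delta>])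
  moreover have "T \<noteq> {}" using B0 by (metis empty_iff)
  moreover have "continuous_on T (\<lambda>M. \<bar>det M\<bar>)"
    by (rule continuous_on_rabs[OF continuous_on_det])
  ultimately have "\<exists>M\<in>T. \<forall>M'\<in>T. \<bar>det M'\<bar> \<le> \<bar>det M\<bar>"
    by (rule continuous_attains_sup)
  then obtain M where M: "M \<in> T" "\<forall>M'\<in>T. \<bar>det M'\<bar> \<le> \<bar>det M\<bar>" ..
  have M\<delta>: "covering M" "\<delta> \<le> \<bar>det M\<bar>" using M(1) by (simp_all add: T_def)
  have "\<bar>det M'\<bar> \<le> \<bar>det M\<bar>" if M': "covering M'" for M'
  proof (cases "\<delta> \<le> \<bar>det M'\<bar>")
    case True
    from into_T[OF M' this] obtain B where "B \<in> T" "\<bar>det B\<bar> = \<bar>det M'\<bar>" ..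
    then show ?thesis using M(2) by metis
  next
    case False
    then show ?thesis using M\<delta>(2) by simp
  qed
  moreover have "det M \<noteq> 0" using \<delta> M\<delta>(2) by auto
  ultimately show ?thesis using M\<delta>(1) by (intro exI[of _ M]) simp
qed

lemma best_real_efficiency_eq:
  assumes "covering M" "det M \<noteq> 0" "\<And>M'. covering M' \<Longrightarrow> \<bar>det M'\<bar> \<le> \<bar>det M\<bar>"
  shows "best_real_efficiency (A 1) = \<bar>det M\<bar> / vol"
proof -
  have "measure lborel (A 1) = vol" by (simp add: borel_closed closed)
  then have eff: "real_efficiencies (A 1) = {\<bar>det M\<bar> / vol | M. det M \<noteq> 0 \<and> covering M}"
    unfolding real_efficiencies_def independent_rows_iff_det by simp
  show ?thesis
    unfolding best_real_efficiency_def eff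
  proof (rule Greatest_equality)
    show "\<bar>det M\<bar> / vol \<in> {\<bar>det M\<bar> / vol | M. det M \<noteq> 0 \<and> covering M}"
      using assms(1,2) by blast
    fix e assume "e \<in> {\<bar>det M\<bar> / vol | M. det M \<noteq> 0 \<and> covering M}"
    then obtain M' where "covering M'" "e = \<bar>det M'\<bar> / vol" by blast
    then show "e \<le> \<bar>det M\<bar> / vol"
      using assms(3)[of M'] vol_pos by (simp add: divide_right_mono)
  qed
qed

text \<open>Passing from \<open>\<int>\<^sup>n\<close> to \<open>\<real>\<^sup>n\<close> costs a unit cube, hence \<open>n\<close> in the radius.\<close>

lemma int_covering_det_le:
  assumes opt: "\<And>M'. covering M' \<Longrightarrow> \<bar>det M'\<bar> \<le> \<Delta>"
    and s: "s \<ge> 0" and cover: "translates_cover Zvec (A s \<inter> Zvec) (row_lattice M)"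
  shows "\<bar>det M\<bar> \<le> (s + real CARD('n)) ^ CARD('n) * \<Delta>"
proof -
  let ?r = "s + real CARD('n)"
  have r: "?r > 0" using s by (simp add: add_nonneg_pos)
  have "covering ((1 / ?r) *\<^sub>R M)"
    unfolding translates_cover_row_lattice
  proof
    fix x :: "real^'n"
    let ?y = "?r *\<^sub>R x"
    let ?z = "\<chi> i. of_int \<lfloor>?y $ i\<rfloor>"
    have "?z \<in> Zvec" by (simp add: Zvec_def)
    then obtain c where c: "c \<in> Zvec" "?z - c v* M \<in> A s"
      using cover unfolding translates_cover_row_lattice by blast
    have "?z - c v* M + (?y - ?z) \<in> A (s + real CARD('n) * 1)"
      using half_box_floor[of ?y] s c(2)
      by (intro enlarge) (auto simp: half_box_def less_imp_le)
    then have "(1 / ?r) *\<^sub>R (?y - c v* M) \<in> A 1"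
      using r by (intro unscale_mem) auto
    also have "(1 / ?r) *\<^sub>R (?y - c v* M) = x - c v* ((1 / ?r) *\<^sub>R M)"
      using r by (simp add: row_action_scaleR scaleR_diff_right)
    finally show "\<exists>c\<in>Zvec. x - c v* ((1 / ?r) *\<^sub>R M) \<in> A 1" using c(1) by blast
  qed
  from opt[OF this] show ?thesis
    using r by (simp add: det_scaleR abs_mult power_divide field_simps)
qed

text \<open>Rounding the rows of \<open>(s - p) M\<close> to integers perturbs points of the fundamental domain
  by a bounded amount, which a shift by a constant vector turns into a nonnegative one.\<close>

lemma int_covering_near_real:
  assumes M: "covering M" "det M \<noteq> 0"
  shows "\<exists>p C q. p \<ge> 0 \<and> q > p \<and> (\<forall>s\<ge>q. \<exists>N. (\<forall>i. N $ i \<in> Zvec) \<and> det N \<noteq> 0 \<and>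
      translates_cover Zvec (A s \<inter> Zvec) (row_lattice N) \<and>
      (s - p) ^ CARD('n) * (\<bar>det M\<bar> - C / (s - p)) \<le> \<bar>det N\<bar>)"
proof -
  let ?n = "real CARD('n)"
  \<comment> \<open>The extra 1 leaves room for rounding, so that \<open>K\<close> also bounds the
    entries of \<open>N\<close> divided by \<open>r\<close>.\<close>
  define K where "K = Max (range (\<lambda>(i, j). \<bar>M $ i $ j\<bar>)) + 1"
  have MK: "\<bar>M $ i $ j\<bar> \<le> K - 1" for i j
    unfolding K_def by (auto intro!: Max_ge)
  have K1: "K \<ge> 1" using MK[of undefined undefined] by linarith
  \<comment> \<open>Bounds the coordinates, relative to \<open>M\<close>, of any point of
    \<open>A 1\<close>.\<close>
  define b where "b = fact CARD('n) * K ^ CARD('n) / \<bar>det M\<bar>"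
  have b: "\<bar>t $ i\<bar> \<le> b" if "t v* M \<in> A 1" for t i
    unfolding b_def
  proof (rule cramer_bound)
    show "\<bar>M $ i $ j\<bar> \<le> K" for i j using MK[of i j] by linarith
    show "\<bar>(t v* M) $ j\<bar> \<le> K" for j using component_le[OF that, of j] K1 by linarith
  qed (use M in auto)
  have b0: "b \<ge> 0" using K1 by (simp add: b_def)
  \<comment> \<open>Bounds each coordinate of the perturbation: one term per row, each a coefficient
    at most \<open>b\<close> times a rounding error at most 1/2.\<close>
  define c where "c = ?n * b / 2"
  have c0: "c \<ge> 0" using b0 by (simp add: c_def)
  \<comment> \<open>Once shifted by \<open>c\<close>, the perturbation lies between 0 and
    \<open>2 * c\<close>; this is the radius that \<open>enlarge\<close> charges for it.\<close>
  define p where "p = ?n * (2 * c)"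
  have p0: "p \<ge> 0" using c0 by (simp add: p_def)
  define C where "C = fact CARD('n) * (K ^ CARD('n) * (?n * (1 / 2 / K)))"
  have C0: "C \<ge> 0" using K1 by (simp add: C_def)
  \<comment> \<open>Makes \<open>s - p\<close> at least 1 and larger than
    \<open>C / \<bar>det M\<bar>\<close>, which keeps \<open>det N\<close> nonzero.\<close>
  define q where "q = p + 1 + C / \<bar>det M\<bar>"
  have q: "q > p" using C0 by (simp add: q_def add_pos_nonneg)
  have main: "\<exists>N. (\<forall>i. N $ i \<in> Zvec) \<and> det N \<noteq> 0 \<and>
      translates_cover Zvec (A s \<inter> Zvec) (row_lattice N) \<and>
      (s - p) ^ CARD('n) * (\<bar>det M\<bar> - C / (s - p)) \<le> \<bar>det N\<bar>" if s: "s \<ge> q" for s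
  proof -
    define r where "r = s - p"
    have r1: "r \<ge> 1" using s C0 divide_nonneg_nonneg[of C "\<bar>det M\<bar>"] unfolding r_def q_def by linarith
    have rC: "C / r < \<bar>det M\<bar>"
    proof -
      have "C / \<bar>det M\<bar> < r" using s unfolding r_def q_def by linarith
      then show ?thesis using M(2) r1 by (simp add: field_simps)
    qed
    define N :: "real^'n^'n" where "N = (\<chi> i j. of_int (round (r * M $ i $ j)))"
    define E where "E = N - r *\<^sub>R M"
    have NZ: "N $ i \<in> Zvec" for i by (simp add: N_def Zvec_def)
    have E: "\<bar>E $ i $ j\<bar> \<le> 1 / 2" for i j
      using of_int_round_abs_le[of "r * M $ i $ j"] by (simp add: E_def N_def)
    have scaled: "N = r *\<^sub>R ((1 / r) *\<^sub>R N)" using r1 by simp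
    have diff: "\<bar>((1 / r) *\<^sub>R N) $ i $ j - M $ i $ j\<bar> \<le> 1 / 2 / r" for i j
    proof -
      have "((1 / r) *\<^sub>R N) $ i $ j - M $ i $ j = E $ i $ j / r"
        using r1 by (simp add: E_def field_simps)
      also have "\<bar>\<dots>\<bar> = \<bar>E $ i $ j\<bar> / r" using r1 by simp
      also have "\<dots> \<le> 1 / 2 / r" by (rule divide_right_mono[OF E]) (use r1 in simp)
      finally show ?thesis .
    qed
    have "\<bar>det ((1 / r) *\<^sub>R N) - det M\<bar> \<le> fact CARD('n) * (K ^ CARD('n) * (?n * (1 / 2 / r / K)))"
    proof (rule det_diff_le[OF _ _ _ diff])
      have "1 / 2 / r \<le> 1" using r1 by (simp add: field_simps)
      then show "\<bar>((1 / r) *\<^sub>R N) $ i $ j\<bar> \<le> K" for i j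
        using diff[of i j] MK[of i j] by linarith
      show "\<bar>M $ i $ j\<bar> \<le> K" for i j using MK[of i j] by linarith
    qed (use K1 in auto)
    also have "\<dots> = C / r" by (simp add: C_def)
    finally have detN: "\<bar>det M\<bar> - C / r \<le> \<bar>det ((1 / r) *\<^sub>R N)\<bar>" by linarith
    have detNr: "\<bar>det N\<bar> = r ^ CARD('n) * \<bar>det ((1 / r) *\<^sub>R N)\<bar>"
      using arg_cong[OF scaled, of "\<lambda>X. \<bar>det X\<bar>"] det_scaleR[of r "(1 / r) *\<^sub>R N"] r1
      by (simp only: abs_mult power_abs abs_of_nonneg)
    have "r ^ CARD('n) * (\<bar>det M\<bar> - C / r) \<le> \<bar>det N\<bar>"
      unfolding detNr using detN r1 by (intro mult_left_mono) auto
    moreover have "0 < r ^ CARD('n) * (\<bar>det M\<bar> - C / r)" using rC r1 by simp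
    ultimately have N0: "det N \<noteq> 0" and Nge: "r ^ CARD('n) * (\<bar>det M\<bar> - C / r) \<le> \<bar>det N\<bar>"
      by auto
    have "translates_cover Zvec (A s \<inter> Zvec) (row_lattice N)"
      unfolding translates_cover_row_lattice
    proof
      fix z :: "real^'n" assume z: "z \<in> Zvec"
      \<comment> \<open>The shift is subtracted before taking coordinates, so that it reappears in
        \<open>?w\<close> beside the rounding error.\<close>
      obtain t where t: "t v* N = z - (\<chi> i. c)" using row_action_surj[OF N0] .
      obtain m where m: "m \<in> Zvec" "t v* M - m v* M \<in> A 1"
        using M(1) unfolding translates_cover_row_lattice by blast
      then have tm: "(t - m) v* M \<in> A 1" by (simp add: vector_matrix_mult_diff_distrib)
      let ?w = "(\<chi> i. c) + (t - m) v* E"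
      have "z - m v* N = (\<chi> i. c) + (t - m) v* N"
        by (simp add: vector_matrix_mult_diff_distrib t)
      also have "(t - m) v* N = r *\<^sub>R ((t - m) v* M) + (t - m) v* E"
        by (simp add: E_def vector_matrix_mult_diff_rdistrib row_action_scaleR)
      finally have eq: "z - m v* N = r *\<^sub>R ((t - m) v* M) + ?w"
        by (simp add: ac_simps)
      have "\<bar>((t - m) v* E) $ j\<bar> \<le> c" for j
      proof -
        have "\<bar>((t - m) v* E) $ j\<bar> \<le> (\<Sum>i\<in>UNIV. \<bar>(t - m) $ i * E $ i $ j\<bar>)"
          unfolding vector_matrix_mult_def by (simp add: sum_abs)
        also have "\<dots> \<le> (\<Sum>i\<in>(UNIV::'n set). b * (1 / 2))"
          unfolding abs_mult by (intro sum_mono mult_mono b[OF tm] E b0) auto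
        finally show ?thesis by (simp add: c_def)
      qed
      then have w: "0 \<le> ?w $ i \<and> ?w $ i \<le> 2 * c" for i
        by (simp add: abs_le_iff) (smt (verit))
      have "r *\<^sub>R ((t - m) v* M) + ?w \<in> A (r + ?n * (2 * c))"
        using r1 tm c0 w by (intro enlarge scale_mem) auto
      then have "z - m v* N \<in> A s" unfolding eq by (simp add: r_def p_def)
      moreover have "z - m v* N \<in> Zvec"
        using z m(1) NZ by (intro Zvec_diff Zvec_mult_matrix)
      ultimately show "\<exists>c\<in>Zvec. z - c v* N \<in> A s \<inter> Zvec" using m(1) by blast
    qed
    then show ?thesis using NZ N0 Nge unfolding r_def by blast
  qed
  show ?thesis using p0 q main by (intro exI[of _ p] exI[of _ C] exI[of _ q]) simp
qed

section \<open>Optimal integer coverings and the error term\<close>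

lemma int_efficiencies_iff:
  "e \<in> int_efficiencies (A s \<inter> Zvec) \<longleftrightarrow>
    (\<exists>M. det M \<noteq> 0 \<and> (\<forall>i. M $ i \<in> Zvec) \<and> translates_cover Zvec (A s \<inter> Zvec) (row_lattice M) \<and>
      e = \<bar>det M\<bar> / real (card (A s \<inter> Zvec)))"
proof -
  have rows: "rows M \<subseteq> Zvec \<longleftrightarrow> (\<forall>i. M $ i \<in> Zvec)" for M :: "real^'n^'n"
    by (auto simp: rows_def row_def)
  show ?thesis
    unfolding int_efficiencies_def int_lattice_def independent_rows_iff_det rows
    by (auto simp: int_index_eq_det) (metis int_index_eq_det)
qed

text \<open>The index of a covering lattice is an integer no larger than the number of points, which
  leaves finitely many quotients.\<close>

lemma finite_int_efficiencies: "finite (int_efficiencies (A s \<inter> Zvec))"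
proof (rule finite_subset)
  let ?N = "card (A s \<inter> Zvec)"
  show "int_efficiencies (A s \<inter> Zvec) \<subseteq> (\<lambda>m. real m / real ?N) ` {..?N}"
  proof
    fix e assume "e \<in> int_efficiencies (A s \<inter> Zvec)"
    then obtain M where M: "det M \<noteq> 0" "\<And>i. M $ i \<in> Zvec"
      "translates_cover Zvec (A s \<inter> Zvec) (row_lattice M)" "e = \<bar>det M\<bar> / real ?N"
      unfolding int_efficiencies_iff by blast
    have "\<bar>det M\<bar> \<le> real ?N"
      by (rule det_le_covering_card) (use M finite_A_Zvec in auto)
    then have "int_index (row_lattice M) \<in> {..?N}"
      using int_index_eq_det[OF M(1,2)] by simp
    then show "e \<in> (\<lambda>m. real m / real ?N) ` {..?N}"
      using M(4) int_index_eq_det[OF M(1,2)] by (metis imageI)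
  qed
qed simp

text \<open>The witness \<open>e\<close> makes the finite set nonempty, so that
  \<open>Greatest\<close> is its maximum; for large \<open>s\<close> the rounded real lattice
  provides one.\<close>

lemma best_int_efficiency_Max:
  assumes "e \<in> int_efficiencies (A s \<inter> Zvec)"
  shows "best_int_efficiency (A s \<inter> Zvec) \<in> int_efficiencies (A s \<inter> Zvec)"
    and "e \<le> best_int_efficiency (A s \<inter> Zvec)"
proof -
  have "best_int_efficiency (A s \<inter> Zvec) = Max (int_efficiencies (A s \<inter> Zvec))"
    unfolding best_int_efficiency_def
    using assms finite_int_efficiencies[of s]
    by (intro Greatest_equality) (auto intro: Max_in Max_ge)
  then show "best_int_efficiency (A s \<inter> Zvec) \<in> int_efficiencies (A s \<inter> Zvec)"
    "e \<le> best_int_efficiency (A s \<inter> Zvec)"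
    using assms finite_int_efficiencies by (auto intro: Max_in Max_ge)
qed

text \<open>The rounded lattice is divided by the upper bound on the count, and the determinant of
  the best integer lattice by the lower one.\<close>

lemma best_int_efficiency_bounds:
  "\<exists>p C q. \<forall>s\<ge>q.
    ((s - p) / (s + real CARD('n))) ^ CARD('n) * (best_real_efficiency (A 1) - C / (s - p))
      \<le> best_int_efficiency (A s \<inter> Zvec) \<and>
    best_int_efficiency (A s \<inter> Zvec)
      \<le> ((s + real CARD('n)) / (s - real CARD('n))) ^ CARD('n) * best_real_efficiency (A 1)"
proof -
  let ?n = "real CARD('n)"
  from optimal_covering obtain M where
    opt: "covering M \<and> det M \<noteq> 0 \<and> (\<forall>M'. covering M' \<longrightarrow> \<bar>det M'\<bar> \<le> \<bar>det M\<bar>)" ..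
  have M: "covering M" "det M \<noteq> 0" "\<And>M'. covering M' \<Longrightarrow> \<bar>det M'\<bar> \<le> \<bar>det M\<bar>"
    using opt by simp_all
  note best = best_real_efficiency_eq[OF M]
  from int_covering_near_real[OF M(1,2)] obtain p C q where pq: "p \<ge> 0" "q > p" and
    near: "\<forall>s\<ge>q. \<exists>N. (\<forall>i. N $ i \<in> Zvec) \<and> det N \<noteq> 0 \<and>
      translates_cover Zvec (A s \<inter> Zvec) (row_lattice N) \<and>
      (s - p) ^ CARD('n) * (\<bar>det M\<bar> - C / (s - p)) \<le> \<bar>det N\<bar>"
    by (elim exE conjE) (rule that)
  show ?thesis
  \<comment> \<open>\<open>C\<close> is divided by \<open>vol\<close> because an efficiency is a
    determinant over a volume; \<open>?n + 1\<close> keeps \<open>s - ?n\<close> positive.\<close>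
  proof (rule exI[of _ p], rule exI[of _ "C / vol"], rule exI[of _ "max q (?n + 1)"], intro allI impI conjI)
    fix s assume "max q (?n + 1) \<le> s"
    then have s: "s \<ge> q" "s > ?n" by auto
    have s0: "s \<ge> 0" using s pq by linarith
    let ?c = "real (card (A s \<inter> Zvec))"
    have lo: "(s - ?n) ^ CARD('n) * vol \<le> ?c" and up: "?c \<le> (s + ?n) ^ CARD('n) * vol"
      using card_ge[OF s(2)] card_le[OF s0] by auto
    have lo0: "0 < (s - ?n) ^ CARD('n) * vol" using s(2) vol_pos by simp
    then have c0: "?c > 0" using lo by linarith
    from near[rule_format, OF s(1)] obtain N where
      N: "\<forall>i. N $ i \<in> Zvec" "det N \<noteq> 0" "translates_cover Zvec (A s \<inter> Zvec) (row_lattice N)"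
        "(s - p) ^ CARD('n) * (\<bar>det M\<bar> - C / (s - p)) \<le> \<bar>det N\<bar>"
      by (elim exE conjE) (rule that)
    then have "\<bar>det N\<bar> / ?c \<in> int_efficiencies (A s \<inter> Zvec)"
      unfolding int_efficiencies_iff by blast
    note max = best_int_efficiency_Max[OF this]
    have "best_real_efficiency (A 1) - C / vol / (s - p) = (\<bar>det M\<bar> - C / (s - p)) / vol"
      by (simp add: best diff_divide_distrib mult.commute)
    then have "((s - p) / (s + ?n)) ^ CARD('n) * (best_real_efficiency (A 1) - C / vol / (s - p))
        = (s - p) ^ CARD('n) * (\<bar>det M\<bar> - C / (s - p)) / ((s + ?n) ^ CARD('n) * vol)"
      by (simp add: power_divide)
    also have "\<dots> \<le> \<bar>det N\<bar> / ((s + ?n) ^ CARD('n) * vol)"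
      using N(4) vol_pos s0 by (intro divide_right_mono) auto
    also have "\<dots> \<le> \<bar>det N\<bar> / ?c"
      using up c0 by (intro divide_left_mono) auto
    also have "\<dots> \<le> best_int_efficiency (A s \<inter> Zvec)" by (rule max)
    finally show "((s - p) / (s + ?n)) ^ CARD('n) * (best_real_efficiency (A 1) - C / vol / (s - p))
        \<le> best_int_efficiency (A s \<inter> Zvec)" .
    obtain D where D: "translates_cover Zvec (A s \<inter> Zvec) (row_lattice D)"
      "best_int_efficiency (A s \<inter> Zvec) = \<bar>det D\<bar> / ?c"
      using max(1) unfolding int_efficiencies_iff by blast
    have "\<bar>det D\<bar> / ?c \<le> (s + ?n) ^ CARD('n) * \<bar>det M\<bar> / ?c"
      using int_covering_det_le[OF M(3) s0 D(1)] c0 by (intro divide_right_mono) auto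
    also have "\<dots> \<le> (s + ?n) ^ CARD('n) * \<bar>det M\<bar> / ((s - ?n) ^ CARD('n) * vol)"
      using lo lo0 c0 s0 by (intro divide_left_mono) auto
    also have "\<dots> = ((s + ?n) / (s - ?n)) ^ CARD('n) * best_real_efficiency (A 1)"
      by (simp add: best power_divide)
    finally show "best_int_efficiency (A s \<inter> Zvec)
        \<le> ((s + ?n) / (s - ?n)) ^ CARD('n) * best_real_efficiency (A 1)" using D(2) by simp
  qed
qed

lemma best_int_efficiency_asymp:
  "(\<lambda>k::nat. best_int_efficiency (A (real k) \<inter> Zvec) - best_real_efficiency (A 1)) \<in> O(\<lambda>k. 1 / real k)"
proof -
  let ?n = "real CARD('n)" and ?\<epsilon> = "best_real_efficiency (A 1)"
  from best_int_efficiency_bounds obtain p C q where bounds: "\<forall>s\<ge>q.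
      ((s - p) / (s + ?n)) ^ CARD('n) * (?\<epsilon> - C / (s - p)) \<le> best_int_efficiency (A s \<inter> Zvec) \<and>
      best_int_efficiency (A s \<inter> Zvec) \<le> ((s + ?n) / (s - ?n)) ^ CARD('n) * ?\<epsilon>"
    by (elim exE) (rule that)
  define \<rho> where "\<rho> k = ((real k + - p) / (real k + ?n)) ^ CARD('n)" for k :: nat
  define \<sigma> where "\<sigma> k = ((real k + ?n) / (real k + - ?n)) ^ CARD('n)" for k :: nat
  have \<rho>: "(\<lambda>k. \<rho> k - 1) \<in> O(\<lambda>k. 1 / real k)" and \<sigma>: "(\<lambda>k. \<sigma> k - 1) \<in> O(\<lambda>k. 1 / real k)"
    unfolding \<rho>_def \<sigma>_def by (rule ratio_power_bigo)+
  have "(\<lambda>k::nat. 1 / real k) \<in> O(\<lambda>_. 1)" by real_asymp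
  then have "(\<lambda>k. \<rho> k - 1) \<in> O(\<lambda>_. 1)" by (rule landau_o.big_trans[OF \<rho>])
  then have \<rho>1: "(\<lambda>k. (\<rho> k - 1) + 1) \<in> O(\<lambda>_. 1)" by (rule sum_in_bigo(1)) simp
  have "(\<lambda>k::nat. 1 / (real k - p)) \<in> O(\<lambda>k. 1 / real k)" by real_asymp
  then have "(\<lambda>k::nat. C * (1 / (real k - p))) \<in> O(\<lambda>k. 1 / real k)" by (rule bigo_cmult)
  from landau_o.big.mult[OF \<rho>1 this]
  have err: "(\<lambda>k. \<rho> k * (C / (real k - p))) \<in> O(\<lambda>k. 1 / real k)" by simp
  \<comment> \<open>This is the lower bound minus \<open>?\<epsilon>\<close>, split into the
    deviation of the ratio from 1 and the rounding loss.\<close>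
  have lo: "(\<lambda>k. ?\<epsilon> * (\<rho> k - 1) - \<rho> k * (C / (real k - p))) \<in> O(\<lambda>k. 1 / real k)"
    by (rule sum_in_bigo(2)[OF bigo_cmult[OF \<rho>] err])
  have up: "(\<lambda>k. ?\<epsilon> * (\<sigma> k - 1)) \<in> O(\<lambda>k. 1 / real k)"
    by (rule bigo_cmult[OF \<sigma>])
  have "eventually (\<lambda>k::nat. real k \<ge> q) at_top" by real_asymp
  then have "eventually (\<lambda>k. ?\<epsilon> * (\<rho> k - 1) - \<rho> k * (C / (real k - p))
        \<le> best_int_efficiency (A (real k) \<inter> Zvec) - ?\<epsilon> \<and>
      best_int_efficiency (A (real k) \<inter> Zvec) - ?\<epsilon> \<le> ?\<epsilon> * (\<sigma> k - 1)) at_top"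
  proof eventually_elim
    case (elim k)
    show ?case
      using bounds[rule_format, OF elim] by (simp add: \<rho>_def \<sigma>_def algebra_simps)
  qed
  then show ?thesis using lo up by (rule bigo_sandwich)
qed

end

section \<open>The cross-polytope and the simplex\<close>

lemma sum_add_le:
  fixes x u :: "real^'n"
  assumes "\<And>i. u $ i \<le> c"
  shows "(\<Sum>i\<in>UNIV. x $ i + u $ i) \<le> (\<Sum>i\<in>UNIV. x $ i) + real CARD('n) * c"
  using sum_bounded_above[of UNIV "\<lambda>i. u $ i" c] assms by (simp add: sum.distrib)

lemma closed_S_bar: "closed (S_bar s)"
  unfolding S_bar_def by (intro closed_Collect_le continuous_intros)

lemma closed_S_bar': "closed (S_bar' s)"
  unfolding S_bar'_def by (intro closed_Collect_conj closed_Collect_all closed_Collect_le continuous_intros)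

lemma covering_body_S_bar: "lattice_covering_body (S_bar :: real \<Rightarrow> (real^'n) set)"
proof
  fix s :: real assume s: "s > 0"
  show "S_bar s = (*\<^sub>R) s ` (S_bar 1 :: (real^'n) set)"
  proof (intro set_eqI iffI)
    fix x :: "real^'n" assume "x \<in> S_bar s"
    then have "(1 / s) *\<^sub>R x \<in> S_bar 1"
      using s by (simp add: S_bar_def abs_mult sum_divide_distrib[symmetric])
    then show "x \<in> (*\<^sub>R) s ` S_bar 1" using s by (intro image_eqI[of _ _ "(1 / s) *\<^sub>R x"]) auto
  next
    fix x :: "real^'n" assume "x \<in> (*\<^sub>R) s ` S_bar 1"
    then show "x \<in> S_bar s" using s by (auto simp: S_bar_def abs_mult sum_distrib_left[symmetric])
  qed
next
  fix s c :: real and x u :: "real^'n"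
  assume x: "x \<in> S_bar s" and u: "\<And>i. 0 \<le> u $ i \<and> u $ i \<le> c"
  have "(\<Sum>i\<in>UNIV. \<bar>x $ i + u $ i\<bar>) \<le> (\<Sum>i\<in>UNIV. \<bar>x $ i\<bar> + c)"
    using u by (intro sum_mono) (smt (verit))
  then show "x + u \<in> S_bar (s + real CARD('n) * c)"
    using x by (simp add: S_bar_def sum.distrib)
next
  fix s :: real and x :: "real^'n"
  assume x: "x \<in> S_bar s"
  \<comment> \<open>Rounding down a negative number can raise its absolute value by up to 1, hence
    the dimension in the radius.\<close>
  have "(\<Sum>i\<in>UNIV. \<bar>of_int \<lfloor>x $ i\<rfloor> :: real\<bar>) \<le> (\<Sum>i\<in>UNIV. \<bar>x $ i\<bar> + 1)"
    by (intro sum_mono) linarith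
  then show "(\<chi> i. of_int \<lfloor>x $ i\<rfloor>) \<in> S_bar (s + real CARD('n))"
    using x by (simp add: S_bar_def sum.distrib)
qed (auto simp: closed_S_bar, auto simp: S_bar_def)

lemma covering_body_S_bar': "lattice_covering_body (S_bar' :: real \<Rightarrow> (real^'n) set)"
proof
  fix s :: real assume s: "s > 0"
  show "S_bar' s = (*\<^sub>R) s ` (S_bar' 1 :: (real^'n) set)"
  proof (intro set_eqI iffI)
    fix x :: "real^'n" assume "x \<in> S_bar' s"
    then have "(1 / s) *\<^sub>R x \<in> S_bar' 1"
      using s by (simp add: S_bar'_def sum_divide_distrib[symmetric])
    then show "x \<in> (*\<^sub>R) s ` S_bar' 1" using s by (intro image_eqI[of _ _ "(1 / s) *\<^sub>R x"]) auto
  next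
    fix x :: "real^'n" assume "x \<in> (*\<^sub>R) s ` S_bar' 1"
    then show "x \<in> S_bar' s" using s by (auto simp: S_bar'_def sum_distrib_left[symmetric])
  qed
next
  fix s c :: real and x u :: "real^'n"
  assume x: "x \<in> S_bar' s" and u: "\<And>i. 0 \<le> u $ i \<and> u $ i \<le> c"
  then show "x + u \<in> S_bar' (s + real CARD('n) * c)"
    using sum_add_le[of u c x] by (auto simp: S_bar'_def)
next
  fix s :: real and x :: "real^'n"
  assume x: "x \<in> S_bar' s"
  have "(\<Sum>i\<in>UNIV. of_int \<lfloor>x $ i\<rfloor> :: real) \<le> (\<Sum>i\<in>UNIV. x $ i)"
    by (intro sum_mono) linarith
  also have "\<dots> \<le> s + real CARD('n)" using x by (simp add: S_bar'_def)
  finally show "(\<chi> i. of_int \<lfloor>x $ i\<rfloor>) \<in> S_bar' (s + real CARD('n))"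
    using x by (simp add: S_bar'_def)
qed (auto simp: closed_S_bar', auto simp: S_bar'_def)

theorem theorem9:
  shows "(\<lambda>k::nat. best_int_efficiency (S (real k) :: (real^'d) set)
            - best_real_efficiency (S_bar 1 :: (real^'d) set)) \<in> O(\<lambda>k. 1 / real k)
       \<and> (\<lambda>k::nat. best_int_efficiency (S' (real k) :: (real^'d) set)
            - best_real_efficiency (S_bar' 1 :: (real^'d) set)) \<in> O(\<lambda>k. 1 / real k)"
  unfolding S_def S'_def
  using lattice_covering_body.best_int_efficiency_asymp[OF covering_body_S_bar]
    lattice_covering_body.best_int_efficiency_asymp[OF covering_body_S_bar']
  by blast

end
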